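(* Let $k\in\mathbb{N}$ and let $A$ be an analytic function in $\mathbb{D}$ such that $\sigma_{M,\deg}(A)=p_2$ and $\lambda_{M,\deg}(A)=p_1$, where $$2k<k\left(2+\frac{p_2-2k}{p_2}\right)<p_1\le p_2<\infty.$$ Then all non-trivial solutions $f$ of $f^{(k)}+Af=0$ in $\mathbb{D}$ satisfy $$\left|\lambda_M(f)-\frac{p_1}{k}+1\right|\le 1-\frac{\lambda_M(f)}{\sigma_M(f)}.$$
   Context: $\mathbb{D}=\{z\in\mathbb{C}:|z|<1\}$, $\mathbb{N}=\{1,2,\dots\}$, $M(r,g)=\max_{|z|=r}|g(z)|$, and $\log^+x=\max\{\log x,0\}$ (with $\log^+0=0$). For $f$ analytic in $\mathbb{D}$, the order and lower order of growth are $$\sigma_M(f)=\limsup_{r\to1^-}\frac{\log^+\log^+M(r,f)}{\log\frac1{1-r}},\qquad \lambda_M(f)=\liminf_{r\to1^-}\frac{\log^+\log^+M(r,f)}{\log\frac1{1-r}}.$$ For $A$ analytic in $\mathbb{D}$, the degree and lower degree of growth are $$\sigma_{M,\deg}(A)=\limsup_{r\to1^-}\frac{\log^+M(r,A)}{\log\frac1{1-r}},\qquad \lambda_{M,\deg}(A)=\liminf_{r\to1^-}\frac{\log^+M(r,A)}{\log\frac1{1-r}}.$$ Solutions are analytic functions in $\mathbb{D}$; non-trivial means not identically zero. *)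

theory Defs
  imports "HOL-Complex_Analysis.Complex_Analysis"
begin

abbreviation unit_disc :: "complex set" (\<open>\<D>\<close>) where
  "\<D> \<equiv> ball 0 1"

text \<open>
  For a function continuous on the circle of radius \<open>r \<ge> 0\<close> the supremum is attained, since the
  circle is compact; so this is the maximum modulus for all \<open>0 \<le> r < 1\<close> if \<open>g\<close> is analytic in the
  unit disc.
\<close>
definition max_modulus :: "real \<Rightarrow> (complex \<Rightarrow> complex) \<Rightarrow> real" where
  "max_modulus r g = (SUP z\<in>sphere 0 r. cmod (g z))"

definition log_plus :: "real \<Rightarrow> real" where
  "log_plus x = (if x = 0 then 0 else max (ln x) 0)"

text \<open>
  The growth indicators may be infinite a priori, hence they take values in the extended reals.
\<close>
definition growth_order :: "(complex \<Rightarrow> complex) \<Rightarrow> ereal" where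
  "growth_order f =
     Limsup (at_left 1) (\<lambda>r. ereal (log_plus (log_plus (max_modulus r f)) / ln (1 / (1 - r))))"

definition lower_growth_order :: "(complex \<Rightarrow> complex) \<Rightarrow> ereal" where
  "lower_growth_order f =
     Liminf (at_left 1) (\<lambda>r. ereal (log_plus (log_plus (max_modulus r f)) / ln (1 / (1 - r))))"

definition growth_degree :: "(complex \<Rightarrow> complex) \<Rightarrow> ereal" where
  "growth_degree A =
     Limsup (at_left 1) (\<lambda>r. ereal (log_plus (max_modulus r A) / ln (1 / (1 - r))))"

definition lower_growth_degree :: "(complex \<Rightarrow> complex) \<Rightarrow> ereal" where
  "lower_growth_degree A =
     Liminf (at_left 1) (\<lambda>r. ereal (log_plus (max_modulus r A) / ln (1 / (1 - r))))"

end

theory Submission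
  imports Defs
begin

text \<open>
  Write \<open>\<sigma>\<close> and \<open>\<lambda>\<close> for the order and the lower order of \<open>f\<close>. The inequality splits into
  \<open>\<lambda> + \<lambda> / \<sigma> \<le> p1 / k\<close> and \<open>p1 / k - 2 \<le> \<lambda> - \<lambda> / \<sigma>\<close>.

  For the first one, compare \<open>f\<close> and its derivatives along a radius with
  \<open>exp (\<integral> M(r, A) powr (1/k))\<close>. If \<open>M(1 - \<delta>, A)\<close> has exponent close to \<open>p1\<close>, the maximum modulus of \<open>A\<close> on
  smaller circles is bounded both by this value and by the degree \<open>p2\<close>; integration gives
  \<open>\<lambda> \<le> (p2 / k - 1) * p1 / p2\<close>, and in the same way \<open>\<sigma> \<le> p2 / k - 1\<close>.

  For the second one, let \<open>ln \<bar>f\<bar>\<close> be at most \<open>\<delta> powr - \<lambda>\<close> in the disc of radius \<open>1 - \<delta>\<close>, and let \<open>\<delta> powr \<lambda> = t powr \<sigma>\<close>. In a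
  Stolz angle with opening close to \<open>\<pi>\<close>, the subharmonic function \<open>ln \<bar>f\<bar>\<close> has a harmonic majorant of size
  \<open>t powr (1 - \<sigma>)\<close> at a fixed point, up to arbitrarily small losses in the exponents. By a Harnack
  type argument, each point at distance about \<open>\<delta>\<close> from the vertex is then close to a point with
  \<open>ln \<bar>f\<bar> \<ge> - M\<close>, where \<open>M = t powr (1 - \<sigma>) / \<delta>\<close>. A local estimate of logarithmic derivatives on a
  disc of radius comparable to \<open>\<delta>\<close> yields \<open>\<bar>A\<bar> powr (1/k) \<le> M / \<delta>\<close>, which is the second inequality.
  The choice \<open>t = \<delta>\<close> gives \<open>p2 / k \<le> max \<sigma> 1 + 1\<close>, hence \<open>\<sigma> = p2 / k - 1\<close>.
\<close>

subsection \<open>Estimates of logarithmic derivatives\<close>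

text \<open>A value with real part below \<open>A\<close> is closer to 0 than to
  \<open>2 * A\<close>, so \<open>m / (2 * A - m)\<close> maps the unit disc into itself and fixes
  0. The Schwarz lemma bounds this quotient by \<open>cmod w\<close>, and solving for
  \<open>m\<close> gives the estimate.\<close>

lemma borel_caratheodory:
  assumes hol: "l holomorphic_on ball a r" and l0: "l a = 0" and A: "A > 0"
    and Re: "\<And>z. z \<in> ball a r \<Longrightarrow> Re (l z) < A" and z: "z \<in> ball a r"
  shows "cmod (l z) \<le> 2 * A * dist a z / (r - dist a z)"
proof -
  have r: "r > 0" using z by (metis ball_eq_empty empty_iff not_le)
  define m where "m w = l (a + of_real r * w)" for w
  define g where "g w = m w / (of_real (2 * A) - m w)" for w
  have in_ball: "a + of_real r * w \<in> ball a r" if "cmod w < 1" for w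
    using that r by (simp add: dist_norm norm_mult)
  have m_less: "cmod (m w) < cmod (of_real (2 * A) - m w)" if "cmod w < 1" for w
  proof -
    have "0 < 4 * A * (A - Re (m w))"
      using Re[OF in_ball[OF that]] A by (simp add: m_def)
    hence "(cmod (m w))\<^sup>2 < (cmod (of_real (2 * A) - m w))\<^sup>2"
      unfolding cmod_power2 by (simp add: power2_eq_square algebra_simps)
    thus ?thesis by (simp add: power2_less_imp_less)
  qed
  have m_hol: "m holomorphic_on ball 0 1"
    unfolding m_def
    by (rule holomorphic_on_compose_gen[unfolded o_def, OF _ hol])
      (use in_ball in \<open>auto intro!: holomorphic_intros simp del: mem_ball\<close>)
  have g_hol: "g holomorphic_on ball 0 1"
    unfolding g_def by (intro holomorphic_intros m_hol) (use m_less in fastforce)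
  define w where "w = (z - a) / of_real r"
  have w: "cmod w < 1" using z r by (simp add: w_def norm_divide dist_norm norm_minus_commute)
  have g_less: "cmod (g w) < 1" if "cmod w < 1" for w
    using m_less[OF that] by (auto simp: g_def norm_divide divide_less_eq_1)
  have "cmod (g w) \<le> cmod w"
    by (rule Schwarz_Lemma(1)[OF g_hol]) (use g_less w l0 in \<open>auto simp: g_def m_def\<close>)
  moreover have mw: "m w = l z" using r by (simp add: m_def w_def)
  ultimately have "cmod (l z) \<le> cmod w * cmod (of_real (2 * A) - l z)"
    using m_less[OF w] by (simp add: g_def norm_divide divide_le_eq split: if_splits)
  also have "\<dots> \<le> cmod w * (2 * A + cmod (l z))"
    using norm_triangle_ineq4[of "of_real (2 * A)" "l z"] A by (intro mult_left_mono) auto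
  finally have "cmod (l z) * (1 - cmod w) \<le> 2 * A * cmod w"
    by (simp add: algebra_simps)
  moreover have "cmod w = dist a z / r"
    using r by (simp add: w_def norm_divide dist_norm norm_minus_commute)
  ultimately have "r * (cmod (l z) * (1 - dist a z / r)) \<le> r * (2 * A * (dist a z / r))"
    using r by (intro mult_left_mono) auto
  hence "cmod (l z) * (r - dist a z) \<le> 2 * A * dist a z"
    using r by (simp add: algebra_simps)
  thus ?thesis using z by (simp add: pos_le_divide_eq)
qed

text \<open>After division by \<open>x + y\<close> both shares lie in the unit interval, where
  \<open>u \<le> u powr p\<close>; the shares add up to 1.\<close>

lemma powr_add_le:
  fixes x y p :: real
  assumes "x \<ge> 0" "y \<ge> 0" "0 < p" "p \<le> 1"
  shows "(x + y) powr p \<le> x powr p + y powr p"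
proof (cases "x + y = 0")
  case False
  hence pos: "x + y > 0" using assms by linarith
  have le: "u / (x + y) \<le> (u / (x + y)) powr p" if "0 \<le> u" "u \<le> x + y" for u
  proof (cases "u = 0")
    case False
    have "(u / (x + y)) powr 1 \<le> (u / (x + y)) powr p"
      by (rule powr_mono') (use that pos assms False in auto)
    thus ?thesis using that pos False by simp
  qed auto
  have "1 = x / (x + y) + y / (x + y)"
    using pos by (simp add: add_divide_distrib[symmetric])
  also have "\<dots> \<le> (x / (x + y)) powr p + (y / (x + y)) powr p"
    using le[of x] le[of y] assms by linarith
  also have "\<dots> = (x powr p + y powr p) / (x + y) powr p"
    using assms pos by (simp add: powr_divide add_divide_distrib)
  finally show ?thesis using pos by (simp add: pos_le_divide_eq)
qed (use assms in auto)

text \<open>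
  The average of the weaker singularities \<open>\<bar>x - b i\<bar> powr - q\<close> is finite, and the
  norm of \<open>\<ell>\<close> with exponent 1 is dominated by the one with exponent \<open>q < 1\<close>; this loses only \<open>n powr (1/q)\<close>, with
  \<open>q\<close> as close to 1 as desired.
\<close>
lemma exists_point_inverse_distance_sum:
  fixes b :: "nat \<Rightarrow> real" and lo hi q :: real
  assumes "lo < hi" and q: "0 < q" "q < 1"
  shows "\<exists>x\<in>{lo..hi}. (\<forall>i<n. x \<noteq> b i) \<and>
           (\<Sum>i<n. 1 / \<bar>x - b i\<bar>) \<le> (3 * real n / (1 - q)) powr (1 / q) / (hi - lo)"
proof (cases "n = 0")
  case False
  define p l where "p = 1 - q" and "l = hi - lo"
  have p: "0 < p" "p < 1" and l: "l > 0" using assms by (auto simp: p_def l_def)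
  \<comment> \<open>Away from 0 this odd function has derivative
    \<open>p * \<bar>t\<bar> powr - q\<close>. It is continuous at 0 because \<open>p > 0\<close>,
    so the fundamental theorem of calculus tolerates the finitely many singular points.\<close>
  define \<phi> :: "real \<Rightarrow> real" where "\<phi> t = (max t 0) powr p - (max (- t) 0) powr p" for t
  define \<Phi> where "\<Phi> x = (\<Sum>i<n. \<phi> (x - b i))" for x
  define S where "S = b ` {..<n}"
  define K where "K = 3 * real n * l powr p / l"
  \<comment> \<open>The value \<open>K\<close> on the finite set \<open>S\<close> keeps
    \<open>K \<le> D x\<close> on the whole open interval without affecting the integral.\<close>
  define D where "D x = (if x \<in> S then K else \<Sum>i<n. p * \<bar>x - b i\<bar> powr (p - 1))" for x
  have cont: "continuous_on UNIV \<phi>"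
    unfolding \<phi>_def by (intro continuous_intros continuous_on_powr') (use p in auto)
  have deriv_\<phi>: "(\<phi> has_real_derivative p * \<bar>t\<bar> powr (p - 1)) (at t)" if "t \<noteq> 0" for t
  proof (cases "t > 0")
    case True
    have "((\<lambda>t. t powr p) has_real_derivative p * \<bar>t\<bar> powr (p - 1)) (at t)"
      using True by (auto intro!: derivative_eq_intros)
    thus ?thesis
      by (rule has_field_derivative_transform_within_open[of _ _ _ "{0<..}"]) (use True p in \<open>auto simp: \<phi>_def max_def\<close>)
  next
    case False
    hence t: "t < 0" using that by simp
    have "((\<lambda>t. - ((- t) powr p)) has_real_derivative p * \<bar>t\<bar> powr (p - 1)) (at t)"
      using t by (auto intro!: derivative_eq_intros)
    thus ?thesis
      by (rule has_field_derivative_transform_within_open[of _ _ _ "{..<0}"]) (use t p in \<open>auto simp: \<phi>_def max_def\<close>)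
  qed
  have inc: "\<phi> v - \<phi> u \<le> 2 * (v - u) powr p" if "u \<le> v" for u v
  proof -
    have *: "max y 0 powr p - max x 0 powr p \<le> (y - x) powr p" if "x \<le> y" for x y :: real
    proof -
      have "max y 0 powr p \<le> (max x 0 + (y - x)) powr p"
        using p that by (intro powr_mono2) auto
      also have "\<dots> \<le> max x 0 powr p + (y - x) powr p"
        using p that by (intro powr_add_le) auto
      finally show ?thesis by simp
    qed
    show ?thesis using *[of u v] *[of "- v" "- u"] that by (simp add: \<phi>_def)
  qed
  have "\<exists>x\<in>{lo<..<hi} - S. (\<Sum>i<n. p * \<bar>x - b i\<bar> powr (p - 1)) \<le> K"
  proof (rule ccontr)
    assume *: "\<not> ?thesis"
    have "(D has_integral (\<Phi> hi - \<Phi> lo)) {lo..hi}"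
    proof (rule fundamental_theorem_of_calculus_interior_strong)
      show "finite S" by (simp add: S_def)
      show "continuous_on {lo..hi} \<Phi>"
        unfolding \<Phi>_def
        by (intro continuous_on_sum continuous_on_compose2[OF cont] continuous_intros) auto
      fix x assume x: "x \<in> {lo<..<hi} - S"
      have "(\<Phi> has_real_derivative D x) (at x)"
        unfolding \<Phi>_def using x
        by (auto intro!: derivative_eq_intros DERIV_chain'[OF _ deriv_\<phi>] simp: D_def S_def)
      thus "(\<Phi> has_vector_derivative D x) (at x)"
        by (simp add: has_real_derivative_iff_has_vector_derivative)
    qed (use assms in auto)
    moreover have "((\<lambda>x. K) has_integral K * l) {lo<..<hi}"
      using has_integral_const_real[of K lo hi] assms
      by (simp add: l_def mult.commute has_integral_Icc_iff_Ioo)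
    moreover have "K \<le> D x" if "x \<in> {lo<..<hi}" for x
      using * that by (force simp: D_def not_le)
    ultimately have "K * l \<le> \<Phi> hi - \<Phi> lo"
      unfolding has_integral_Icc_iff_Ioo by (meson has_integral_le)
    also have "\<dots> = (\<Sum>i<n. \<phi> (hi - b i) - \<phi> (lo - b i))"
      by (simp add: \<Phi>_def sum_subtractf)
    also have "\<dots> \<le> (\<Sum>i<n. 2 * l powr p)"
    proof (rule sum_mono)
      show "\<phi> (hi - b i) - \<phi> (lo - b i) \<le> 2 * l powr p" for i
        using inc[of "lo - b i" "hi - b i"] assms by (simp add: l_def)
    qed
    \<comment> \<open>The left side is \<open>3 * n * l powr p\<close>, the right side
      \<open>2 * n * l powr p\<close>; the factor 3 in \<open>K\<close> is there to make this
      contradictory.\<close>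
    finally show False using l False by (simp add: K_def)
  qed
  then obtain x where x: "x \<in> {lo<..<hi} - S" and le: "(\<Sum>i<n. p * \<bar>x - b i\<bar> powr (p - 1)) \<le> K"
    by blast
  have nz: "x \<noteq> b i" if "i < n" for i using x that by (auto simp: S_def)
  define Y where "Y = 3 * real n / p * l powr - q"
  have Y: "Y > 0" using False p l by (simp add: Y_def)
  have sumY: "(\<Sum>i<n. \<bar>x - b i\<bar> powr - q) \<le> Y"
  proof -
    have "l powr p / l = l powr - q"
      using l by (simp add: p_def powr_diff powr_minus divide_simps)
    moreover have "p * (\<Sum>i<n. \<bar>x - b i\<bar> powr - q) \<le> 3 * real n * (l powr p / l)"
      using le by (simp add: K_def p_def sum_distrib_left)
    ultimately have "p * (\<Sum>i<n. \<bar>x - b i\<bar> powr - q) \<le> p * Y"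
      using p by (simp add: Y_def)
    thus ?thesis using p by simp
  qed
  \<comment> \<open>The exponent -1 is split as \<open>- q + - q * (1 / q - 1)\<close>. The second
    power is bounded through the whole sum, whose summands are nonnegative.\<close>
  have term_le: "1 / \<bar>x - b i\<bar> \<le> \<bar>x - b i\<bar> powr - q * Y powr (1 / q - 1)" if "i < n" for i
  proof -
    have "\<bar>x - b i\<bar> powr - q \<le> (\<Sum>i<n. \<bar>x - b i\<bar> powr - q)"
      by (rule member_le_sum) (use that in auto)
    hence "(\<bar>x - b i\<bar> powr - q) powr (1 / q - 1) \<le> Y powr (1 / q - 1)"
      using sumY q by (intro powr_mono2) auto
    hence "\<bar>x - b i\<bar> powr - q * (\<bar>x - b i\<bar> powr - q) powr (1 / q - 1)
             \<le> \<bar>x - b i\<bar> powr - q * Y powr (1 / q - 1)"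
      by (intro mult_left_mono) auto
    moreover have "\<bar>x - b i\<bar> powr - q * (\<bar>x - b i\<bar> powr - q) powr (1 / q - 1) = 1 / \<bar>x - b i\<bar>"
    proof -
      have "- q + - q * (1 / q - 1) = - 1" using q by (simp add: field_simps)
      thus ?thesis
        using nz[OF that] unfolding powr_powr powr_add[symmetric]
        by (simp add: powr_minus divide_inverse)
    qed
    ultimately show ?thesis by simp
  qed
  have "(\<Sum>i<n. 1 / \<bar>x - b i\<bar>) \<le> (\<Sum>i<n. \<bar>x - b i\<bar> powr - q) * Y powr (1 / q - 1)"
    unfolding sum_distrib_right using term_le by (intro sum_mono) auto
  also have "\<dots> \<le> Y * Y powr (1 / q - 1)"
    by (intro mult_right_mono sumY) auto
  also have "\<dots> = Y powr (1 / q)"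
    using Y by (simp add: powr_diff)
  also have "\<dots> = (3 * real n / p) powr (1 / q) * (l powr - q) powr (1 / q)"
    unfolding Y_def using p l by (intro powr_mult) 
  also have "(l powr - q) powr (1 / q) = 1 / l"
    unfolding powr_powr using l q by (simp add: powr_minus divide_inverse)
  finally have "(\<Sum>i<n. 1 / \<bar>x - b i\<bar>) \<le> (3 * real n / (1 - q)) powr (1 / q) / (hi - lo)"
    by (simp add: p_def l_def)
  thus ?thesis using x nz by (intro bexI[of _ x]) auto
qed (use assms in \<open>auto intro!: exI[of _ lo] simp: Bex_def\<close>)

text \<open>Each zero is at distance at least \<open>3 * R / 4\<close> from the boundary circle and
  at most \<open>R / 4\<close> from the centre. Hence each linear factor contributes a ratio of at
  least 3, and the maximum principle for \<open>h\<close> turns this into the gain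
  \<open>3 ^ n\<close>. This one estimate serves both to bound the number of zeros, as in Jensen's
  formula, and to bound the quotient \<open>h\<close>.\<close>

lemma polynomial_factor_bound:
  fixes a :: "nat \<Rightarrow> complex"
  assumes S: "open S" "cball z1 R \<subseteq> S" and R: "R > 0"
    and le: "\<And>z. z \<in> cball z1 R \<Longrightarrow> cmod (f z) \<le> exp M"
    and ge: "cmod (f z1) \<ge> exp (- M)"
    and h: "h holomorphic_on S" and a: "\<And>i. i < n \<Longrightarrow> dist z1 (a i) \<le> R / 4"
    and fact: "\<And>z. z \<in> S \<Longrightarrow> f z = (\<Prod>i<n. z - a i) * h z"
    and z: "z \<in> cball z1 R"
  shows "3 ^ n * cmod (h z) \<le> exp (2 * M) * cmod (h z1)"
proof -
  have "cmod (h z) \<le> exp M / (3 * R / 4) ^ n"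
  proof (rule maximum_modulus_frontier[where S = "cball z1 R" and f = h])
    show "h holomorphic_on interior (cball z1 R)"
      by (rule holomorphic_on_subset[OF h]) (use S interior_subset in blast)
    show "continuous_on (closure (cball z1 R)) h"
      using h S by (metis closed_cball closure_closed continuous_on_subset holomorphic_on_imp_continuous_on)
    fix w assume "w \<in> frontier (cball z1 R)"
    hence w: "dist z1 w = R" using R by (simp add: frontier_cball)
    have far: "3 * R / 4 \<le> cmod (w - a i)" if "i < n" for i
      using w a[OF that] dist_triangle[of z1 w "a i"] by (simp add: dist_norm norm_minus_commute)
    have "(3 * R / 4) ^ n = (\<Prod>i<n. 3 * R / 4)" by simp
    also have "\<dots> \<le> (\<Prod>i<n. cmod (w - a i))"
      by (rule prod_mono) (use far R in auto)
    finally have "(3 * R / 4) ^ n * cmod (h w) \<le> (\<Prod>i<n. cmod (w - a i)) * cmod (h w)"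
      by (intro mult_right_mono) auto
    also have "\<dots> = cmod (f w)"
      using fact[of w] S w by (auto simp: norm_mult prod_norm)
    also have "\<dots> \<le> exp M" using le[of w] w by simp
    finally show "cmod (h w) \<le> exp M / (3 * R / 4) ^ n"
      using R by (simp add: pos_le_divide_eq mult.commute)
  qed (use z in auto)
  hence 1: "(3 * R / 4) ^ n * cmod (h z) \<le> exp M"
    using R by (simp add: pos_le_divide_eq mult.commute)
  have "z1 \<in> S" using S R by (metis centre_in_cball less_imp_le subsetD)
  hence "exp (- M) \<le> (\<Prod>i<n. cmod (z1 - a i)) * cmod (h z1)"
    using ge fact[of z1] by (simp add: norm_mult prod_norm)
  also have "\<dots> \<le> (\<Prod>i<n. R / 4) * cmod (h z1)"
    by (intro mult_right_mono prod_mono) (use a in \<open>auto simp: dist_norm\<close>)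
  finally have 2: "exp (- M) \<le> (R / 4) ^ n * cmod (h z1)" by simp
  have "(R / 4) ^ n * (3 ^ n * cmod (h z)) \<le> exp M"
    using 1 by (simp add: power_mult_distrib power_divide mult_ac)
  also have "\<dots> = exp (2 * M) * exp (- M)" by (simp flip: exp_add)
  also have "\<dots> \<le> exp (2 * M) * ((R / 4) ^ n * cmod (h z1))" using 2 by simp
  finally have "(R / 4) ^ n * (3 ^ n * cmod (h z)) \<le> (R / 4) ^ n * (exp (2 * M) * cmod (h z1))"
    by (simp add: mult_ac)
  thus ?thesis by (rule mult_left_le_imp_le) (use R in simp)
qed

text \<open>Any factorisation with \<open>n\<close> zeros satisfies
  \<open>exp n \<le> 3 ^ n \<le> exp (2 * M)\<close>, so there is one with a maximal number of
  factors. A remaining zero of \<open>h\<close> in the small disc could be split off, against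
  maximality.\<close>

lemma exists_factorisation:
  assumes S: "open S" "cball z1 R \<subseteq> S" and R: "R > 0" and f: "f holomorphic_on S"
    and le: "\<And>z. z \<in> cball z1 R \<Longrightarrow> cmod (f z) \<le> exp M"
    and ge: "cmod (f z1) \<ge> exp (- M)"
  obtains n :: nat and a h where "h holomorphic_on S" "\<And>i. i < n \<Longrightarrow> dist z1 (a i) \<le> R / 4"
    "\<And>z. z \<in> S \<Longrightarrow> f z = (\<Prod>i<n. z - a i) * h z"
    "\<And>z. z \<in> cball z1 (R / 4) \<Longrightarrow> h z \<noteq> 0"
    "real n \<le> 2 * M"
    "\<And>z. z \<in> cball z1 R \<Longrightarrow> cmod (h z) \<le> exp (2 * M) * cmod (h z1)"
proof -
  define P where "P n \<longleftrightarrow> (\<exists>a h. h holomorphic_on S \<and> (\<forall>i<n. dist z1 (a i) \<le> R / 4) \<and>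
      (\<forall>z\<in>S. f z = (\<Prod>i<n. z - a i) * h z))" for n :: nat
  have P0: "P 0" unfolding P_def by (intro exI[of _ "\<lambda>_. 0"] exI[of _ f]) (use f in auto)
  have n_le: "real n \<le> 2 * M" and h_le: "z \<in> cball z1 R \<Longrightarrow> cmod (h z) \<le> exp (2 * M) * cmod (h z1)"
    if h: "h holomorphic_on S" and a: "\<forall>i<n. dist z1 (a i) \<le> R / 4"
      and fact: "\<forall>z\<in>S. f z = (\<Prod>i<n. z - a i) * h z"
    for n :: nat and a h z
  proof -
    have *: "3 ^ n * cmod (h z) \<le> exp (2 * M) * cmod (h z1)" if "z \<in> cball z1 R" for z
      by (rule polynomial_factor_bound[where S = S and R = R and f = f and a = a])
        (use S R le ge h a fact that in auto)
    have "h z1 \<noteq> 0"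
    proof
      assume "h z1 = 0"
      moreover have "z1 \<in> S" using S R by (metis centre_in_cball less_imp_le subsetD)
      ultimately have "f z1 = 0" using fact by auto
      thus False using ge by (simp add: not_le[symmetric])
    qed
    have "3 ^ n * cmod (h z1) \<le> exp (2 * M) * cmod (h z1)"
      by (rule *) (use R in auto)
    hence "3 ^ n \<le> exp (2 * M)" using \<open>h z1 \<noteq> 0\<close> by simp
    moreover have "exp (real n) \<le> 3 ^ n"
    proof -
      have "exp 1 ^ n \<le> (3 :: real) ^ n" by (intro power_mono exp_le) auto
      thus ?thesis by (simp add: exp_of_nat_mult[symmetric])
    qed
    ultimately have "exp (real n) \<le> exp (2 * M)" by linarith
    thus "real n \<le> 2 * M" by simp
    assume z: "z \<in> cball z1 R"
    have "cmod (h z) \<le> 3 ^ n * cmod (h z)"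
      using mult_right_mono[of 1 "3 ^ n" "cmod (h z)"] by simp
    also have "\<dots> \<le> exp (2 * M) * cmod (h z1)"
      by (rule *) (use z in auto)
    finally show "cmod (h z) \<le> exp (2 * M) * cmod (h z1)" .
  qed
  have bound: "n \<le> nat \<lceil>2 * M\<rceil>" if "P n" for n
    using that n_le unfolding P_def by (smt (verit) le_nat_iff le_of_int_ceiling nat_le_iff of_int_of_nat_eq of_nat_ceiling of_nat_le_iff real_nat_ceiling_ge)
  define n where "n = (GREATEST n. P n)"
  have Pn: "P n" unfolding n_def by (rule GreatestI_nat[where P = P, OF P0]) (use bound in auto)
  have max: "m \<le> n" if "P m" for m unfolding n_def by (rule Greatest_le_nat[where P = P, OF that]) (use bound in auto)
  obtain a h where h: "h holomorphic_on S" and a: "\<forall>i<n. dist z1 (a i) \<le> R / 4"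
    and fact: "\<forall>z\<in>S. f z = (\<Prod>i<n. z - a i) * h z"
    using Pn unfolding P_def by blast
  have "h w \<noteq> 0" if w: "w \<in> cball z1 (R / 4)" for w
  proof
    assume hw: "h w = 0"
    \<comment> \<open>The value at \<open>w\<close> fills the removable singularity of
      \<open>h z / (z - w)\<close>.\<close>
    define g where "g z = (if z = w then deriv h w else h z / (z - w))" for z
    have "g holomorphic_on S"
      using pole_theorem_open_0[OF h S(1), of w g] hw by (auto simp: g_def)
    moreover have "f z = (\<Prod>i<Suc n. z - (a(n := w)) i) * g z" if "z \<in> S" for z
    proof -
      have "(\<Prod>i<n. z - (a(n := w)) i) = (\<Prod>i<n. z - a i)" by (rule prod.cong) auto
      moreover have "h z = (z - w) * g z" using hw by (auto simp: g_def)
      ultimately show ?thesis using fact that by simp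
    qed
    moreover have "\<forall>i<Suc n. dist z1 ((a(n := w)) i) \<le> R / 4" using a w by (auto simp: less_Suc_eq)
    ultimately have "P (Suc n)" unfolding P_def by blast
    thus False using max by fastforce
  qed
  thus ?thesis using that[OF h, of n a] a fact n_le[OF h a fact] h_le[OF h a fact] by blast
qed

text \<open>
  By Cauchy's inequality, a bound on \<open>f (z + w) / f z\<close> for \<open>\<bar>w\<bar> = 1 / T\<close> gives one for
  the derivative of order \<open>k\<close> divided by \<open>f\<close>; no expansion of the derivatives of a product is needed.
\<close>
lemma logarithmic_derivative_on_circle:
  fixes k :: nat and q :: real
  assumes q: "0 < q" "q < 1"
  obtains C where "C > 0"
    "\<And>S f z1 R M. \<lbrakk>open S; cball z1 R \<subseteq> S; R > 0; M \<ge> 1; f holomorphic_on S;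
       \<And>z. z \<in> cball z1 R \<Longrightarrow> cmod (f z) \<le> exp M; cmod (f z1) \<ge> exp (- M)\<rbrakk> \<Longrightarrow>
       \<exists>\<rho>\<in>{R/32..R/16}. \<forall>z. dist z1 z = \<rho> \<longrightarrow>
          f z \<noteq> 0 \<and> cmod ((deriv ^^ k) f z) \<le> C * (M powr (1 / q) / R) ^ k * cmod (f z)"
proof
  \<comment> \<open>The first summand comes from the zeros, with \<open>n \<le> 2 * M\<close> and an
    interval of radii of length \<open>R / 32\<close>; the second is the bound for the derivative of
    the logarithm of \<open>h\<close>.\<close>
  define C0 where "C0 = 32 * (6 / (1 - q)) powr (1 / q) + 288"
  have C0: "C0 \<ge> 288" unfolding C0_def by simp
  show "fact k * exp 1 * C0 ^ k > 0" using C0 by simp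
  fix S f z1 and R M :: real
  assume S: "open S" "cball z1 R \<subseteq> S" and R: "R > 0" and M: "M \<ge> 1" and f: "f holomorphic_on S"
    and le: "\<And>z. z \<in> cball z1 R \<Longrightarrow> cmod (f z) \<le> exp M" and ge: "cmod (f z1) \<ge> exp (- M)"
  obtain n :: nat and a h where h: "h holomorphic_on S" and a: "\<And>i. i < n \<Longrightarrow> dist z1 (a i) \<le> R / 4"
    and fact: "\<And>z. z \<in> S \<Longrightarrow> f z = (\<Prod>i<n. z - a i) * h z"
    and hnz: "\<And>z. z \<in> cball z1 (R / 4) \<Longrightarrow> h z \<noteq> 0"
    and n: "real n \<le> 2 * M"
    and hle: "\<And>z. z \<in> cball z1 R \<Longrightarrow> cmod (h z) \<le> exp (2 * M) * cmod (h z1)"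
    using exists_factorisation[OF S R f le ge] by metis
  have sub: "cball z1 r \<subseteq> S" if "r \<le> R" for r
    using S that by (meson dual_order.trans subset_cball)
  have hol: "h holomorphic_on ball z1 (R / 4)"
    by (rule holomorphic_on_subset[OF h]) (use sub[of "R / 4"] R ball_subset_cball in auto)
  obtain g where g: "g holomorphic_on ball z1 (R / 4)" and hg: "\<And>z. z \<in> ball z1 (R / 4) \<Longrightarrow> h z = exp (g z)"
    using contractible_imp_holomorphic_log[OF hol] hnz
    by (metis ball_subset_cball convex_ball convex_imp_contractible subsetD)
  \<comment> \<open>Normalised to vanish at \<open>z1\<close>, as the Borel-Caratheodory estimate
    requires; its real part is \<open>ln (cmod (h z / h z1))\<close>.\<close>
  define l where "l z = g z - g z1" for z
  have l: "l holomorphic_on ball z1 (R / 4)" unfolding l_def by (intro holomorphic_intros g)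
  have hl: "h z = h z1 * exp (l z)" if "z \<in> ball z1 (R / 4)" for z
    using hg[OF that] hg[of z1] R by (simp add: l_def exp_diff)
  have Re_l: "Re (l z) < 3 * M" if "z \<in> ball z1 (R / 4)" for z
  proof -
    have "cmod (h z1) * exp (Re (l z)) \<le> exp (2 * M) * cmod (h z1)"
      using hle[of z] that hl[OF that] R by (simp add: norm_mult)
    moreover have "h z1 \<noteq> 0" using hnz[of z1] R by simp
    ultimately have "Re (l z) \<le> 2 * M" by simp
    thus ?thesis using M by simp
  qed
  \<comment> \<open>The radius \<open>3 * R / 16\<close> leaves a margin \<open>R / 16\<close>
    inside the disc of radius \<open>R / 4\<close>. Cauchy's inequality on discs of radius
    \<open>R / 16\<close> then gives the derivative bound \<open>288 * M / R\<close> on the disc of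
    radius \<open>R / 8\<close>.\<close>
  have l_le: "cmod (l z) \<le> 18 * M" if "dist z1 z \<le> 3 * R / 16" for z
  proof -
    have "cmod (l z) \<le> 2 * (3 * M) * dist z1 z / (R / 4 - dist z1 z)"
      by (rule borel_caratheodory[OF l]) (use Re_l that R M in \<open>auto simp: l_def\<close>)
    also have "\<dots> \<le> 2 * (3 * M) * (3 * R / 16) / (R / 4 - 3 * R / 16)"
      using that R M by (intro frac_le mult_left_mono) auto
    also have "\<dots> = 18 * M" using R by (simp add: field_simps)
    finally show ?thesis .
  qed
  have l_deriv: "cmod (deriv l z) \<le> 288 * M / R" if z: "z \<in> cball z1 (R / 8)" for z
  proof -
    have sub': "cball z (R / 16) \<subseteq> ball z1 (R / 4)"
    proof
      fix x assume "x \<in> cball z (R / 16)"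
      thus "x \<in> ball z1 (R / 4)" using z R dist_triangle[of z1 x z] by simp
    qed
    have "cmod ((deriv ^^ 1) l z) \<le> fact 1 * (18 * M) / (R / 16) ^ 1"
    proof (rule Cauchy_inequality)
      show "l holomorphic_on ball z (R / 16)"
        by (rule holomorphic_on_subset[OF l]) (use sub' ball_subset_cball in blast)
      show "continuous_on (cball z (R / 16)) l"
        by (rule holomorphic_on_imp_continuous_on[OF holomorphic_on_subset[OF l sub']])
      fix x assume "cmod (z - x) = R / 16"
      thus "cmod (l x) \<le> 18 * M"
        using z dist_triangle[of z1 x z] by (intro l_le) (simp add: dist_norm)
    qed (use R in auto)
    thus ?thesis by simp
  qed
  have l_lip: "cmod (l w - l z) \<le> 288 * M / R * cmod (w - z)"
    if "w \<in> cball z1 (R / 8)" "z \<in> cball z1 (R / 8)" for w z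
  proof (rule field_differentiable_bound[where S = "cball z1 (R / 8)" and f' = "deriv l"])
    fix x assume x: "x \<in> cball z1 (R / 8)"
    hence "x \<in> ball z1 (R / 4)" using R by auto
    thus "(l has_field_derivative deriv l x) (at x within cball z1 (R / 8))"
      using l by (meson holomorphic_derivI open_ball)
    show "cmod (deriv l x) \<le> 288 * M / R" by (rule l_deriv[OF x])
  qed (use that in auto)
  \<comment> \<open>On the circle of radius \<open>\<rho>\<close> the distance to each zero is at
    least the difference of the two radii, so a one-dimensional choice controls the whole
    circle.\<close>
  obtain \<rho> where \<rho>: "\<rho> \<in> {R/32..R/16}" and \<rho>_ne: "\<forall>i<n. \<rho> \<noteq> dist z1 (a i)"
    and \<rho>_sum: "(\<Sum>i<n. 1 / \<bar>\<rho> - dist z1 (a i)\<bar>) \<le> (3 * real n / (1 - q)) powr (1 / q) / (R/16 - R/32)"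
    using exists_point_inverse_distance_sum[of "R/32" "R/16" q n "\<lambda>i. dist z1 (a i)"] R q by auto
  \<comment> \<open>\<open>T\<close> dominates the total logarithmic rate of change of
    \<open>f\<close>: the zeros and the zero-free factor together. Moving by \<open>1 / T\<close>
    therefore costs at most a factor \<open>exp 1\<close>, while \<open>1 / T \<le> R / 16\<close>
    keeps the moved point in the disc of radius \<open>R / 8\<close>.\<close>
  define T where "T = C0 * (M powr (1 / q) / R)"
  have M_le: "M \<le> M powr (1 / q)"
    using powr_mono[of 1 "1 / q" M] q M by (simp add: divide_simps)
  have T_ge: "16 / R \<le> T"
  proof -
    have "16 * 1 \<le> C0 * M powr (1 / q)"
      by (intro mult_mono) (use C0 M M_le in auto)
    thus ?thesis using R by (simp add: T_def divide_right_mono)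
  qed
  hence T: "T > 0" using R by (meson divide_pos_pos less_le_trans zero_less_numeral)
  have sum_le: "(\<Sum>i<n. 1 / \<bar>\<rho> - dist z1 (a i)\<bar>) + 288 * M / R \<le> T"
  proof -
    have "(3 * real n / (1 - q)) powr (1 / q) \<le> (6 / (1 - q) * M) powr (1 / q)"
      using n q by (intro powr_mono2) (auto simp: divide_right_mono)
    also have "\<dots> = (6 / (1 - q)) powr (1 / q) * M powr (1 / q)"
      using q M by (intro powr_mult)
    finally have "(3 * real n / (1 - q)) powr (1 / q) / (R/16 - R/32)
        \<le> (6 / (1 - q)) powr (1 / q) * M powr (1 / q) / (R/16 - R/32)"
      using R by (intro divide_right_mono) auto
    also have "\<dots> = 32 * (6 / (1 - q)) powr (1 / q) * (M powr (1 / q) / R)"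
      using R by (simp add: field_simps)
    finally have "(\<Sum>i<n. 1 / \<bar>\<rho> - dist z1 (a i)\<bar>)
        \<le> 32 * (6 / (1 - q)) powr (1 / q) * (M powr (1 / q) / R)" using \<rho>_sum by linarith
    moreover have "288 * M / R \<le> 288 * (M powr (1 / q) / R)"
      using M_le R by (simp add: divide_right_mono)
    ultimately show ?thesis by (simp add: T_def C0_def algebra_simps)
  qed
  show "\<exists>\<rho>\<in>{R/32..R/16}. \<forall>z. dist z1 z = \<rho> \<longrightarrow>
      f z \<noteq> 0 \<and> cmod ((deriv ^^ k) f z) \<le> fact k * exp 1 * C0 ^ k * (M powr (1 / q) / R) ^ k * cmod (f z)"
  proof (intro bexI[OF _ \<rho>] allI impI conjI)
    fix z assume z: "dist z1 z = \<rho>"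
    have zR: "dist z1 z \<le> R / 16" using z \<rho> by auto
    have zS: "z \<in> S" using sub[of "R / 16"] zR R by auto
    have near: "\<bar>\<rho> - dist z1 (a i)\<bar> \<le> cmod (z - a i)" for i
      using z norm_triangle_ineq3[of "z1 - z" "z1 - a i"] by (simp add: dist_norm norm_minus_commute)
    have pos: "0 < \<bar>\<rho> - dist z1 (a i)\<bar>" if "i < n" for i using \<rho>_ne that by auto
    have "z - a i \<noteq> 0" if "i < n" for i using near[of i] pos[OF that] by auto
    moreover have "h z \<noteq> 0" using hnz[of z] zR R by auto
    ultimately show "f z \<noteq> 0" using fact[OF zS] by simp
    \<comment> \<open>Each linear factor changes by at most
      \<open>1 + 1 / (cmod (z - a i) * T)\<close>, which is bounded by an exponential, and
      \<open>h\<close> by its Lipschitz bound; the exponents then add up to at most 1.\<close>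
    have shift: "cmod (f w) \<le> exp 1 * cmod (f z)" if w: "cmod (z - w) = 1 / T" for w
    proof -
      have invT: "1 / T \<le> R / 16" using T_ge R T by (simp add: field_simps)
      have w_le: "dist z1 w \<le> R / 8"
        using dist_triangle[of z1 w z] zR w invT by (simp add: dist_norm)
      have wS: "w \<in> S" using sub[of "R / 8"] w_le R by auto
      have fac: "cmod (w - a i) \<le> cmod (z - a i) * exp (1 / \<bar>\<rho> - dist z1 (a i)\<bar> / T)" if "i < n" for i
      proof -
        have p: "cmod (z - a i) > 0" using near[of i] pos[OF that] by linarith
        have "cmod (w - a i) \<le> cmod (z - a i) + 1 / T"
          using norm_triangle_ineq[of "z - a i" "w - z"] w by (simp add: norm_minus_commute)
        also have "\<dots> = cmod (z - a i) * (1 + 1 / cmod (z - a i) / T)"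
          using p by (simp add: field_simps)
        also have "\<dots> \<le> cmod (z - a i) * exp (1 / cmod (z - a i) / T)"
          by (intro mult_left_mono exp_ge_add_one_self) auto
        also have "\<dots> \<le> cmod (z - a i) * exp (1 / \<bar>\<rho> - dist z1 (a i)\<bar> / T)"
        proof -
          have "1 / cmod (z - a i) \<le> 1 / \<bar>\<rho> - dist z1 (a i)\<bar>"
            using near[of i] pos[OF that] by (intro frac_le) auto
          hence "1 / cmod (z - a i) / T \<le> 1 / \<bar>\<rho> - dist z1 (a i)\<bar> / T"
            using T by (intro divide_right_mono) auto
          thus ?thesis by (intro mult_left_mono) auto
        qed
        finally show ?thesis .
      qed
      have "cmod (h w) = cmod (h z) * exp (Re (l w - l z))"
      proof -
        have "h w = h z * exp (l w - l z)"
          using hl[of w] hl[of z] w_le zR R by (simp add: exp_diff)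
        thus ?thesis by (simp add: norm_mult)
      qed
      also have "\<dots> \<le> cmod (h z) * exp (288 * M / R / T)"
      proof -
        have "Re (l w - l z) \<le> 288 * M / R * cmod (w - z)"
          using l_lip[of w z] complex_Re_le_cmod[of "l w - l z"] w_le zR R by auto
        thus ?thesis using w by (intro mult_left_mono) (auto simp: norm_minus_commute mult.commute)
      qed
      finally have h_le: "cmod (h w) \<le> cmod (h z) * exp (288 * M / R / T)" .
      have "cmod (f w) = (\<Prod>i<n. cmod (w - a i)) * cmod (h w)"
        using fact[OF wS] by (simp add: norm_mult prod_norm)
      also have "\<dots> \<le> (\<Prod>i<n. cmod (z - a i) * exp (1 / \<bar>\<rho> - dist z1 (a i)\<bar> / T)) *
          (cmod (h z) * exp (288 * M / R / T))"
        using fac h_le by (intro mult_mono prod_mono prod_nonneg) auto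
      also have "\<dots> = cmod (f z) * exp (((\<Sum>i<n. 1 / \<bar>\<rho> - dist z1 (a i)\<bar>) + 288 * M / R) / T)"
        using fact[OF zS]
        by (simp add: norm_mult prod_norm prod.distrib exp_sum[symmetric] sum_divide_distrib
            add_divide_distrib exp_add)
      also have "\<dots> \<le> cmod (f z) * exp 1"
        using sum_le T by (intro mult_left_mono) auto
      finally show ?thesis by (simp add: mult.commute)
    qed
    have subw: "cball z (1 / T) \<subseteq> S"
    proof
      fix w assume "w \<in> cball z (1 / T)"
      moreover have "1 / T \<le> R / 16" using T_ge R T by (simp add: field_simps)
      ultimately have "dist z1 w \<le> R / 8" using dist_triangle[of z1 w z] zR by simp
      thus "w \<in> S" using sub[of "R / 8"] R by auto
    qed
    have "cmod ((deriv ^^ k) f z) \<le> fact k * (exp 1 * cmod (f z)) / (1 / T) ^ k"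
    proof (rule Cauchy_inequality)
      show "f holomorphic_on ball z (1 / T)"
        by (rule holomorphic_on_subset[OF f]) (use subw ball_subset_cball in blast)
      show "continuous_on (cball z (1 / T)) f"
        by (rule holomorphic_on_imp_continuous_on[OF holomorphic_on_subset[OF f subw]])
    qed (use T shift in auto)
    also have "\<dots> = fact k * exp 1 * C0 ^ k * (M powr (1 / q) / R) ^ k * cmod (f z)"
      by (simp add: T_def power_mult_distrib power_divide)
    finally show "cmod ((deriv ^^ k) f z) \<le> fact k * exp 1 * C0 ^ k * (M powr (1 / q) / R) ^ k * cmod (f z)" .
  qed
qed

text \<open>On the good circle the equation gives
  \<open>cmod (A w) = cmod ((deriv ^^ k) f w) / cmod (f w)\<close>. Since \<open>A\<close> is
  holomorphic, the maximum principle carries the bound inside, in particular to points near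
  \<open>z1\<close> at which \<open>f\<close> itself may vanish.\<close>

lemma coefficient_bound_near_point:
  fixes k :: nat and q :: real
  assumes q: "0 < q" "q < 1"
  obtains C where "C > 0"
    "\<And>S f A z1 z R M. \<lbrakk>open S; cball z1 R \<subseteq> S; R > 0; M \<ge> 1; f holomorphic_on S; A holomorphic_on S;
       \<And>z. z \<in> S \<Longrightarrow> (deriv ^^ k) f z + A z * f z = 0;
       \<And>z. z \<in> cball z1 R \<Longrightarrow> cmod (f z) \<le> exp M; cmod (f z1) \<ge> exp (- M); dist z1 z \<le> R / 32\<rbrakk> \<Longrightarrow>
       cmod (A z) \<le> C * (M powr (1 / q) / R) ^ k"
proof -
  obtain C where C: "C > 0" and *:
    "\<And>S f z1 R M. \<lbrakk>open S; cball z1 R \<subseteq> S; R > 0; M \<ge> 1; f holomorphic_on S;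
       \<And>z. z \<in> cball z1 R \<Longrightarrow> cmod (f z) \<le> exp M; cmod (f z1) \<ge> exp (- M)\<rbrakk> \<Longrightarrow>
       \<exists>\<rho>\<in>{R/32..R/16}. \<forall>z. dist z1 z = \<rho> \<longrightarrow>
          f z \<noteq> 0 \<and> cmod ((deriv ^^ k) f z) \<le> C * (M powr (1 / q) / R) ^ k * cmod (f z)"
    using logarithmic_derivative_on_circle[OF q, of k] by blast
  show ?thesis
  proof (rule that[OF C])
    fix S f A z1 z and R M :: real
    assume S: "open S" "cball z1 R \<subseteq> S" and R: "R > 0" and M: "M \<ge> 1" and f: "f holomorphic_on S"
      and A: "A holomorphic_on S" and ode: "\<And>z. z \<in> S \<Longrightarrow> (deriv ^^ k) f z + A z * f z = 0"
      and le: "\<And>z. z \<in> cball z1 R \<Longrightarrow> cmod (f z) \<le> exp M" and ge: "cmod (f z1) \<ge> exp (- M)"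
      and z: "dist z1 z \<le> R / 32"
    obtain \<rho> where \<rho>: "\<rho> \<in> {R/32..R/16}" and bound: "\<And>z. dist z1 z = \<rho> \<Longrightarrow>
        f z \<noteq> 0 \<and> cmod ((deriv ^^ k) f z) \<le> C * (M powr (1 / q) / R) ^ k * cmod (f z)"
      using *[OF S R M f le ge] by blast
    have sub: "cball z1 \<rho> \<subseteq> S"
      by (rule order_trans[OF _ S(2)], rule subset_cball) (use \<rho> R in auto)
    have hol: "A holomorphic_on cball z1 \<rho>" using A sub holomorphic_on_subset by blast
    show "cmod (A z) \<le> C * (M powr (1 / q) / R) ^ k"
    proof (rule maximum_modulus_frontier[where S = "cball z1 \<rho>" and f = A])
      show "A holomorphic_on interior (cball z1 \<rho>)"
        by (rule holomorphic_on_subset[OF hol interior_subset])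
      show "continuous_on (closure (cball z1 \<rho>)) A"
        using hol by (simp add: holomorphic_on_imp_continuous_on)
      fix w assume "w \<in> frontier (cball z1 \<rho>)"
      hence w: "dist z1 w = \<rho>" by auto
      hence "w \<in> S" using sub by auto
      hence "cmod ((deriv ^^ k) f w) = cmod (A w) * cmod (f w)"
        using ode[of w] by (metis add_eq_0_iff norm_minus_cancel norm_mult)
      thus "cmod (A w) \<le> C * (M powr (1 / q) / R) ^ k"
        using bound[OF w] by (auto intro: mult_right_le_imp_le)
    qed (use z \<rho> in auto)
  qed
qed

subsection \<open>Growth of solutions\<close>

text \<open>Consider the first radius \<open>r\<close> at which some component reaches its majorant.
  All strict inequalities hold before it, so the mean value inequality bounds the growth of that
  component on \<open>{0..r}\<close> by the growth of its majorant. The strict inequality at 0 then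
  persists at \<open>r\<close>, a contradiction.\<close>

lemma differential_inequality_system:
  fixes u u' :: "nat \<Rightarrow> real \<Rightarrow> 'a::real_normed_vector" and \<phi> \<phi>' :: "nat \<Rightarrow> real \<Rightarrow> real"
  assumes u: "\<And>j. j < k \<Longrightarrow> continuous_on {0..\<rho>} (u j)"
    and \<phi>: "\<And>j. j < k \<Longrightarrow> continuous_on {0..\<rho>} (\<phi> j)"
    and u': "\<And>j x. \<lbrakk>j < k; 0 < x; x < \<rho>\<rbrakk> \<Longrightarrow> (u j has_vector_derivative u' j x) (at x)"
    and \<phi>': "\<And>j x. \<lbrakk>j < k; 0 < x; x < \<rho>\<rbrakk> \<Longrightarrow> (\<phi> j has_real_derivative \<phi>' j x) (at x)"
    and init: "\<And>j. j < k \<Longrightarrow> norm (u j 0) < \<phi> j 0"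
    and step: "\<And>j x. \<lbrakk>j < k; 0 < x; x < \<rho>; \<forall>i<k. norm (u i x) < \<phi> i x\<rbrakk> \<Longrightarrow> norm (u' j x) \<le> \<phi>' j x"
    and x: "x \<in> {0..\<rho>}" and j: "j < k"
  shows "norm (u j x) < \<phi> j x"
proof (rule ccontr)
  assume neg: "\<not> norm (u j x) < \<phi> j x"
  define T where "T i = {x\<in>{0..\<rho>}. \<phi> i x - norm (u i x) \<le> 0}" for i
  define U where "U = (\<Union>i<k. T i)"
  have "closed (T i)" if "i < k" for i
    unfolding T_def
    by (intro continuous_on_closed_Collect_le continuous_intros u \<phi> that)
  hence "closed U" unfolding U_def by (intro closed_UN) auto
  moreover have "x \<in> T j" using x neg by (simp add: T_def)
  hence "x \<in> U" using j unfolding U_def by blast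
  moreover have bb: "bdd_below U" unfolding U_def T_def by (intro bdd_belowI[of _ 0]) auto
  ultimately have "Inf U \<in> U" by (intro closed_contains_Inf) auto
  then obtain i where i: "i < k" and Ti: "Inf U \<in> T i" unfolding U_def by blast
  define r where "r = Inf U"
  have less: "norm (u l y) < \<phi> l y" if "l < k" "0 \<le> y" "y < r" for l y
  proof (rule ccontr)
    assume "\<not> ?thesis"
    hence "y \<in> T l" using that Ti by (auto simp: T_def r_def)
    hence "y \<in> U" using that unfolding U_def by blast
    hence "r \<le> y" unfolding r_def by (intro cInf_lower bb)
    thus False using that by simp
  qed
  have r: "0 \<le> r" "r \<le> \<rho>" "\<phi> i r \<le> norm (u i r)" using Ti by (auto simp: T_def r_def)
  have "r \<noteq> 0" using r init[OF i] by auto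
  hence "0 < r" using r by simp
  have "norm (u i r - u i 0) \<le> \<phi> i r - \<phi> i 0"
  proof (rule differentiable_bound_general[OF \<open>0 < r\<close>, where f' = "u' i" and \<phi>' = "\<phi>' i"])
    show "continuous_on {0..r} (u i)" "continuous_on {0..r} (\<phi> i)"
      using u[OF i] \<phi>[OF i] r by (auto intro: continuous_on_subset)
    fix x assume x: "0 < x" "x < r"
    show "(u i has_vector_derivative u' i x) (at x)" using u'[OF i] x r by auto
    show "(\<phi> i has_vector_derivative \<phi>' i x) (at x)"
      using \<phi>'[OF i] x r by (auto simp: has_real_derivative_iff_has_vector_derivative[symmetric])
    show "norm (u' i x) \<le> \<phi>' i x" using step[OF i] less x r by auto
  qed
  moreover have "norm (u i r) \<le> norm (u i r - u i 0) + norm (u i 0)"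
    by (metis diff_add_cancel norm_triangle_ineq)
  ultimately show False using init[OF i] r by linarith
qed

text \<open>
  Along a radius, \<open>N r ^ j * E r\<close> with \<open>N r = C * (1 + t - r) powr - s\<close> and
  \<open>E r = exp (\<integral> N)\<close> is a supersolution for the derivative of order \<open>j\<close>.
\<close>
lemma solution_growth:
  fixes k :: nat and A f :: "complex \<Rightarrow> complex" and s C t \<rho> K :: real
  assumes k: "k \<ge> 1" and f: "f holomorphic_on \<D>"
    and ode: "\<And>z. z \<in> \<D> \<Longrightarrow> (deriv ^^ k) f z + A z * f z = 0"
    and s: "s > 1" and C: "C > 0" and t: "0 \<le> t" "t \<le> 1" and \<rho>: "\<rho> < 1"
    and A: "\<And>z. cmod z \<le> \<rho> \<Longrightarrow> cmod (A z) \<le> (C * (1 + t - cmod z) powr - s) ^ k"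
    and init: "\<And>j. j < k \<Longrightarrow> cmod ((deriv ^^ j) f 0) < K * (C * 2 powr - s) ^ j"
    and z: "cmod z \<le> \<rho>"
  shows "cmod (f z) \<le> K * exp (C / (s - 1) * (1 + t - cmod z) powr (1 - s))"
proof -
  \<comment> \<open>The direction of the radius through \<open>z\<close>; at the origin any
    direction will do.\<close>
  define \<zeta> where "\<zeta> = (if z = 0 then 1 else sgn z)"
  have \<zeta>: "cmod \<zeta> = 1" by (simp add: \<zeta>_def norm_sgn)
  have z_eq: "z = of_real (cmod z) * \<zeta>" by (simp add: \<zeta>_def sgn_div_norm scaleR_conv_of_real)
  define N where "N r = C * (1 + t - r) powr - s" for r
  define E where "E r = exp (C / (s - 1) * (1 + t - r) powr (1 - s))" for r
  define N' where "N' r = C * s * (1 + t - r) powr (- s - 1)" for r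
  define u where "u j r = (deriv ^^ j) f (of_real r * \<zeta>)" for j and r :: real
  have K: "K > 0"
  proof -
    have "cmod ((deriv ^^ 0) f 0) < K * (C * 2 powr - s) ^ 0" by (rule init) (use k in simp)
    thus ?thesis by (simp add: le_less_trans[OF norm_ge_zero])
  qed
  have N_pos: "N r > 0" if "r < 1" for r using that C t by (simp add: N_def)
  have N': "(N has_real_derivative N' r) (at r)" if "r < 1" for r
    unfolding N_def N'_def using that t by (auto intro!: derivative_eq_intros simp: field_simps)
  have E': "(E has_real_derivative N r * E r) (at r)" if "r < 1" for r
  proof -
    have "((\<lambda>r. (1 + t - r) powr (1 - s)) has_real_derivative (s - 1) * (1 + t - r) powr - s) (at r)"
      using that t by (auto intro!: derivative_eq_intros simp: algebra_simps)
    hence "((\<lambda>r. exp (C / (s - 1) * (1 + t - r) powr (1 - s))) has_real_derivative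
        exp (C / (s - 1) * (1 + t - r) powr (1 - s)) *
          (C / (s - 1) * ((s - 1) * (1 + t - r) powr - s))) (at r)"
      by (intro DERIV_chain2[OF DERIV_exp] DERIV_cmult)
    thus ?thesis unfolding N_def E_def using s by (simp add: mult.commute)
  qed
  have E_ge: "E r \<ge> 1" for r using C s by (simp add: E_def)
  have hol: "(deriv ^^ j) f holomorphic_on \<D>" for j
    by (intro holomorphic_higher_deriv f) auto
  have in_disc: "of_real r * \<zeta> \<in> \<D>" if "0 \<le> r" "r \<le> \<rho>" for r :: real
    using that \<rho> \<zeta> by (simp add: norm_mult)
  have u': "(u j has_vector_derivative \<zeta> * u (Suc j) r) (at r)" if "0 \<le> r" "r \<le> \<rho>" for j r
  proof -
    have "((deriv ^^ j) f has_field_derivative (deriv ^^ Suc j) f (of_real r * \<zeta>)) (at (of_real r * \<zeta>))"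
      using holomorphic_derivI[OF hol open_ball in_disc[OF that]] by simp
    moreover have "((\<lambda>r. of_real r * \<zeta>) has_vector_derivative \<zeta>) (at r)"
      by (auto intro!: derivative_eq_intros)
    ultimately show ?thesis
      unfolding u_def using field_vector_diff_chain_at[of "\<lambda>r. of_real r * \<zeta>" \<zeta> r "(deriv ^^ j) f"]
      by (simp add: o_def)
  qed
  have *: "cmod (u j x) < K * N x ^ j * E x" if "x \<in> {0..\<rho>}" "j < k" for j x
  proof (rule differential_inequality_system[where k = k and \<rho> = \<rho> and u' = "\<lambda>j r. \<zeta> * u (Suc j) r"
        and \<phi>' = "\<lambda>j r. K * (real j * N r ^ (j - 1) * N' r * E r + N r ^ Suc j * E r)", OF _ _ _ _ _ _ that])
    fix j assume j: "j < k"
    show "continuous_on {0..\<rho>} (u j)"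
      by (intro continuous_at_imp_continuous_on ballI has_vector_derivative_continuous[OF u']) auto
    have \<phi>': "((\<lambda>r. K * N r ^ j * E r) has_real_derivative
        K * (real j * N r ^ (j - 1) * N' r * E r + N r ^ Suc j * E r)) (at r)" if "r < 1" for r
      using that by (auto intro!: derivative_eq_intros N' E' simp: algebra_simps)
    show "continuous_on {0..\<rho>} (\<lambda>r. K * N r ^ j * E r)"
      by (intro continuous_at_imp_continuous_on ballI DERIV_isCont[OF \<phi>']) (use \<rho> in auto)
    have "(C * 2 powr - s) ^ j \<le> N 0 ^ j"
      unfolding N_def using C s t by (intro power_mono mult_left_mono powr_mono2') auto
    hence "K * (C * 2 powr - s) ^ j \<le> K * N 0 ^ j * E 0"
      using K E_ge[of 0] N_pos[of 0] mult_mono[of "K * (C * 2 powr - s) ^ j" "K * N 0 ^ j" 1 "E 0"] by simp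
    thus "cmod (u j 0) < K * N 0 ^ j * E 0" using init[OF j] by (simp add: u_def)
    fix x assume x: "0 < x" "x < \<rho>"
    show "(u j has_vector_derivative \<zeta> * u (Suc j) x) (at x)" using u' x by simp
    show "((\<lambda>r. K * N r ^ j * E r) has_real_derivative
        K * (real j * N x ^ (j - 1) * N' x * E x + N x ^ Suc j * E x)) (at x)"
      using \<phi>' x \<rho> by simp
    assume less: "\<forall>i<k. cmod (u i x) < K * N x ^ i * E x"
    \<comment> \<open>For \<open>Suc j < k\<close> this is the next component's inequality. For
      \<open>Suc j = k\<close> the differential equation closes the system: the derivative of order
      \<open>k\<close> has modulus \<open>cmod (A z) * cmod (f z)\<close>, and \<open>A\<close> is
      bounded by \<open>N x ^ k\<close>.\<close>
    have "cmod (u (Suc j) x) \<le> K * N x ^ Suc j * E x"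
    proof (cases "Suc j = k")
      case True
      have "of_real x * \<zeta> \<in> \<D>" using in_disc x by simp
      hence "cmod (u k x) = cmod (A (of_real x * \<zeta>)) * cmod (u 0 x)"
        using ode[of "of_real x * \<zeta>"] unfolding u_def
        by (metis add_eq_0_iff norm_minus_cancel norm_mult funpow_0)
      also have "\<dots> \<le> N x ^ k * (K * N x ^ 0 * E x)"
      proof (rule mult_mono)
        show "cmod (A (of_real x * \<zeta>)) \<le> N x ^ k"
          using A[of "of_real x * \<zeta>"] x \<zeta> by (simp add: N_def norm_mult)
        show "cmod (u 0 x) \<le> K * N x ^ 0 * E x" using less k by (meson less_eq_real_def less_le_trans zero_less_one)
      qed (use N_pos x \<rho> in \<open>auto simp: less_imp_le\<close>)
      finally show ?thesis using True by (simp add: mult_ac)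
    next
      case False
      hence "Suc j < k" using j by simp
      thus ?thesis using less[rule_format, of "Suc j"] by simp
    qed
    \<comment> \<open>This summand of the derivative of the majorant comes from
      \<open>N x ^ j\<close>; it is nonnegative because \<open>N\<close> is increasing, so the
      summand from \<open>E\<close> alone suffices.\<close>
    moreover have "0 \<le> K * (real j * N x ^ (j - 1) * N' x * E x)"
      using K N_pos[of x] x \<rho> C s t E_ge[of x] by (auto simp: N'_def intro!: mult_nonneg_nonneg)
    ultimately show "cmod (\<zeta> * u (Suc j) x) \<le> K * (real j * N x ^ (j - 1) * N' x * E x + N x ^ Suc j * E x)"
      using \<zeta> by (simp add: norm_mult distrib_left mult_ac)
  qed
  have "cmod (u 0 (cmod z)) < K * N (cmod z) ^ 0 * E (cmod z)"
    by (rule *) (use z k in auto)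
  thus ?thesis using z_eq by (simp add: u_def E_def less_imp_le)
qed

text \<open>The better of the two bounds is the one at \<open>max x t\<close>, and
  \<open>t + x \<le> 2 * max x t\<close>. Thus a global bound and a bound on a fixed disc merge into
  a single shifted power.\<close>

lemma le_powr_add_of_le_powr:
  fixes x t e D y :: real
  assumes "x > 0" "t > 0" "e \<ge> 0" "D \<ge> 0" "y \<le> D * x powr - e" "y \<le> D * t powr - e"
  shows "y \<le> D * 2 powr e * (t + x) powr - e"
proof -
  define m where "m = max x t"
  have m: "m > 0" "y \<le> D * m powr - e" using assms by (auto simp: m_def max_def)
  have "m powr - e = 2 powr e * (2 * m) powr - e"
    using m by (simp add: powr_mult powr_minus field_simps)
  also have "\<dots> \<le> 2 powr e * (t + x) powr - e"
    using assms by (intro mult_left_mono powr_mono2') (auto simp: m_def)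
  finally have "D * m powr - e \<le> D * (2 powr e * (t + x) powr - e)"
    using assms by (intro mult_left_mono) auto
  thus ?thesis using m by (simp add: mult_ac)
qed

text \<open>The degree bound and the bound at the radius \<open>1 - \<delta>\<close> combine to a
  multiple of \<open>(1 + t - cmod z) powr - e\<close>, whose root of order \<open>k\<close> has an
  integral of size \<open>t powr (1 - s)\<close>. The constants \<open>K\<close> and
  \<open>C\<close> do not depend on \<open>\<delta>\<close>, so the estimate can be applied to all
  radii or only to a sequence of them.\<close>

lemma solution_growth_at_radius:
  fixes k :: nat and A f :: "complex \<Rightarrow> complex" and s D \<mu> :: real
  assumes k: "k \<ge> 1" and f: "f holomorphic_on \<D>"
    and ode: "\<And>z. z \<in> \<D> \<Longrightarrow> (deriv ^^ k) f z + A z * f z = 0"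
    and s: "s > 1" and \<mu>: "0 < \<mu>"
    and A: "\<And>z. z \<in> \<D> \<Longrightarrow> cmod (A z) \<le> D * (1 - cmod z) powr - (real k * s)"
  obtains K C where "K > 0" "C > 0"
    "\<And>\<delta> z. \<lbrakk>0 < \<delta>; \<delta> < 1; \<And>w. cmod w \<le> 1 - \<delta> \<Longrightarrow> cmod (A w) \<le> \<delta> powr - \<mu>; cmod z \<le> 1 - \<delta>\<rbrakk>
       \<Longrightarrow> cmod (f z) \<le> K * exp (C * \<delta> powr - ((s - 1) * \<mu> / (real k * s)))"
proof -
  define e where "e = real k * s"
  have e: "e > 0" using k s by (simp add: e_def)
  define D' where "D' = max D 1"
  \<comment> \<open>Chosen so that \<open>C ^ k = D' * 2 powr e\<close>, the constant of the merged
    bound for \<open>A\<close>.\<close>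
  define C where "C = (D' * 2 powr e) powr (1 / real k)"
  have D': "D' \<ge> 1" "D' \<ge> D" by (auto simp: D'_def)
  have C: "C > 0" using D' by (simp add: C_def)
  have C_pow: "(C * y powr - s) ^ k = D' * 2 powr e * y powr - e" if "y > 0" for y
  proof -
    have "C ^ k = D' * 2 powr e"
      using D' k by (simp add: C_def powr_realpow[symmetric] powr_powr)
    moreover have "(y powr - s) ^ k = y powr - e"
      using that by (simp add: powr_realpow[symmetric] powr_powr e_def mult.commute)
    ultimately show ?thesis by (simp add: power_mult_distrib)
  qed
  \<comment> \<open>The sum dominates each initial derivative in its scaled form; the summand 1
    makes the initial inequalities strict.\<close>
  define K where "K = 1 + (\<Sum>j<k. cmod ((deriv ^^ j) f 0) / (C * 2 powr - s) ^ j)"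
  have K: "K > 0" unfolding K_def by (intro add_pos_nonneg sum_nonneg) (use C in auto)
  have init: "cmod ((deriv ^^ j) f 0) < K * (C * 2 powr - s) ^ j" if "j < k" for j
  proof -
    have "cmod ((deriv ^^ j) f 0) / (C * 2 powr - s) ^ j
        \<le> (\<Sum>j<k. cmod ((deriv ^^ j) f 0) / (C * 2 powr - s) ^ j)"
      by (rule member_le_sum) (use that C in auto)
    hence "cmod ((deriv ^^ j) f 0) / (C * 2 powr - s) ^ j < K" by (simp add: K_def)
    thus ?thesis using C by (simp add: pos_divide_less_eq)
  qed
  show ?thesis
  proof (rule that[of K "C / (s - 1)"])
    fix \<delta> :: real and z
    assume \<delta>: "0 < \<delta>" "\<delta> < 1" and le: "\<And>w. cmod w \<le> 1 - \<delta> \<Longrightarrow> cmod (A w) \<le> \<delta> powr - \<mu>"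
      and z: "cmod z \<le> 1 - \<delta>"
    \<comment> \<open>At distance \<open>t\<close> from the unit circle the power with exponent
      \<open>- e\<close> equals the bound \<open>\<delta> powr - \<mu>\<close> assumed at the radius
      \<open>1 - \<delta>\<close>.\<close>
    define t where "t = \<delta> powr (\<mu> / e)"
    have t: "0 < t" "t \<le> 1" using \<delta> \<mu> e by (auto simp: t_def powr_le1)
    have t_pow: "t powr - e = \<delta> powr - \<mu>" using e by (simp add: t_def powr_powr)
    have "cmod (f z) \<le> K * exp (C / (s - 1) * (1 + t - cmod z) powr (1 - s))"
    proof (rule solution_growth[OF k f ode s C _ _ _ _ init z])
      fix w assume w: "cmod w \<le> 1 - \<delta>"
      have "cmod (A w) \<le> D' * 2 powr e * (t + (1 - cmod w)) powr - e"
      proof (rule le_powr_add_of_le_powr)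
        have "cmod (A w) \<le> D * (1 - cmod w) powr - e" using A[of w] w \<delta> by (simp add: e_def)
        also have "\<dots> \<le> D' * (1 - cmod w) powr - e" using D' by (intro mult_right_mono) auto
        finally show "cmod (A w) \<le> D' * (1 - cmod w) powr - e" .
        have "cmod (A w) \<le> 1 * t powr - e" using le[OF w] t_pow by simp
        also have "\<dots> \<le> D' * t powr - e" using D' by (intro mult_right_mono) auto
        finally show "cmod (A w) \<le> D' * t powr - e" .
      qed (use w \<delta> t e D' in auto)
      also have "\<dots> = (C * (1 + t - cmod w) powr - s) ^ k"
        using C_pow[of "1 + t - cmod w"] w \<delta> t by (simp add: algebra_simps)
      finally show "cmod (A w) \<le> (C * (1 + t - cmod w) powr - s) ^ k" .
    qed (use t \<delta> in auto)
    also have "\<dots> \<le> K * exp (C / (s - 1) * t powr (1 - s))"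
    proof -
      have "(1 + t - cmod z) powr (1 - s) \<le> t powr (1 - s)"
        using s t z \<delta> by (intro powr_mono2') auto
      hence "C / (s - 1) * (1 + t - cmod z) powr (1 - s) \<le> C / (s - 1) * t powr (1 - s)"
        using C s by (intro mult_left_mono) auto
      thus ?thesis using K by simp
    qed
    also have "t powr (1 - s) = \<delta> powr - ((s - 1) * \<mu> / (real k * s))"
    proof -
      have "\<mu> / e * (1 - s) = - ((s - 1) * \<mu> / (real k * s))"
        by (simp add: e_def algebra_simps diff_divide_distrib)
      thus ?thesis unfolding t_def powr_powr by simp
    qed
    finally show "cmod (f z) \<le> K * exp (C / (s - 1) * \<delta> powr - ((s - 1) * \<mu> / (real k * s)))" .
  qed (use K C s in auto)
qed

subsection \<open>Lower bounds in a Stolz angle\<close>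

text \<open>
  Comparison of \<open>G\<close> with a power of the Blaschke factor of the disc \<open>ball 1 1\<close> with zero at \<open>d\<close>, whose
  modulus at the centre 1 is \<open>1 - d\<close>.
\<close>
lemma exists_point_lower_bound:
  assumes G: "G holomorphic_on ball 1 1" "continuous_on (cball 1 1) G"
    and le: "\<And>v. v \<in> cball 1 1 \<Longrightarrow> cmod (G v) \<le> 1" and ge: "cmod (G 1) \<ge> exp (- L)"
    and L: "L \<ge> 0" and d: "0 < d" "d \<le> 1 / 2"
  shows "\<exists>v. dist (of_real d) v = d / 100 \<and> cmod (G v) \<ge> exp (- (8 * (L / d + 1)))"
proof (rule ccontr)
  assume neg: "\<not> ?thesis"
  \<comment> \<open>Larger than \<open>L / d\<close>, to contradict the value at the centre, but at
    most \<open>L / d + 1\<close>, to match the claimed lower bound.\<close>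
  define N where "N = Suc (nat \<lfloor>L / d\<rfloor>)"
  have N: "L / d < real N" "real N \<le> L / d + 1"
    using L d by (auto simp: N_def) linarith+
  define r where "r = d / 100"
  define W where "W = cball (1 :: complex) 1 - ball (of_real d) r"
  \<comment> \<open>The reciprocal of the Blaschke factor: it has modulus 1 on the boundary circle,
    a pole at \<open>d\<close> and the value \<open>1 / (1 - d)\<close> at the centre. A small disc
    around the pole is removed to form \<open>W\<close>.\<close>
  define b where "b v = (of_real d + of_real (1 - d) * v) / (v - of_real d)" for v :: complex
  have int: "interior W \<subseteq> ball 1 1 - {of_real d}"
  proof -
    have "interior W \<subseteq> interior (cball 1 1)" by (rule interior_mono) (auto simp: W_def)
    moreover have "of_real d \<notin> W" using d by (simp add: W_def r_def)
    ultimately show ?thesis using interior_subset[of W] by auto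
  qed
  have closedW: "closed W" unfolding W_def by (intro closed_Diff) auto
  have front: "v \<in> sphere 1 1 \<or> v \<in> sphere (of_real d) r" if v: "v \<in> frontier W" for v
  proof (rule ccontr)
    assume "\<not> ?thesis"
    moreover have "v \<in> W" using v closedW frontier_subset_closed by blast
    ultimately have "v \<in> ball 1 1 - cball (of_real d) r" by (auto simp: W_def)
    moreover have "ball 1 1 - cball (of_real d) r \<subseteq> W" by (auto simp: W_def)
    moreover have "open (ball (1 :: complex) 1 - cball (of_real d) r)" by (intro open_Diff) auto
    ultimately have "v \<in> interior W" by (meson interior_maximal subsetD)
    thus False using v by (simp add: frontier_def)
  qed
  have b_sphere: "cmod (b v) = 1" if "v \<in> sphere 1 1" "v \<noteq> of_real d" for v
  proof -
    have "(Re v - 1)\<^sup>2 + (Im v)\<^sup>2 = 1"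
      using that cmod_power2[of "1 - v"] by (simp add: dist_norm power2_eq_square algebra_simps)
    hence "(cmod (of_real d + of_real (1 - d) * v))\<^sup>2 = (cmod (v - of_real d))\<^sup>2"
      unfolding cmod_power2 by (simp add: power2_eq_square) algebra
    thus ?thesis using that by (simp add: b_def norm_divide)
  qed
  \<comment> \<open>On the removed circle the quotient is at most 201, which is below
    \<open>2 ^ 8\<close>. This is the source of the 8 in the exponent of the statement.\<close>
  have b_small: "cmod (b v) \<le> exp 8" if "v \<in> sphere (of_real d) r" for v
  proof -
    have v: "cmod (v - of_real d) = d / 100" using that by (simp add: dist_norm r_def norm_minus_commute)
    have "cmod v \<le> cmod (v - of_real d) + cmod (of_real d)" by (metis diff_add_cancel norm_triangle_ineq)
    hence "cmod v \<le> 101 / 100 * d" using v d by simp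
    moreover have "cmod (of_real d + of_real (1 - d) * v) \<le> d + (1 - d) * cmod v"
      using d norm_triangle_ineq[of "of_real d" "of_real (1 - d) * v"] by (simp add: norm_mult del: of_real_diff)
    moreover have "(1 - d) * cmod v \<le> 1 * cmod v" using d by (intro mult_right_mono) auto
    ultimately have "cmod (of_real d + of_real (1 - d) * v) \<le> 201 / 100 * d" by linarith
    hence "cmod (b v) \<le> 201 / 100 * d / (d / 100)"
      unfolding b_def norm_divide v using d by (intro divide_right_mono) auto
    also have "\<dots> = 201" using d by simp
    finally have "cmod (b v) \<le> 201" .
    also have "201 \<le> (2 :: real) ^ 8" by simp
    also have "\<dots> \<le> exp 1 ^ 8" using exp_ge_add_one_self[of "1 :: real"] by (intro power_mono) auto
    also have "\<dots> = exp (8 :: real)" by (simp add: exp_of_nat_mult[symmetric])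
    finally show ?thesis .
  qed
  have "cmod (G 1 * b 1 ^ N) \<le> 1"
  proof (rule maximum_modulus_frontier[where S = W and f = "\<lambda>v. G v * b v ^ N"])
    show "(\<lambda>v. G v * b v ^ N) holomorphic_on interior W"
      unfolding b_def
      by (intro holomorphic_intros holomorphic_on_subset[OF G(1)]) (use int in auto)
    show "continuous_on (closure W) (\<lambda>v. G v * b v ^ N)"
      unfolding closure_closed[OF closedW] b_def
      by (intro continuous_intros continuous_on_subset[OF G(2)]) (use d in \<open>auto simp: W_def r_def\<close>)
    show "bounded W" by (rule bounded_subset[OF bounded_cball]) (auto simp: W_def)
    have "dist (of_real d) (1 :: complex) = 1 - d"
      using d norm_of_real[of "1 - d", where 'a = complex] by (simp add: dist_norm norm_minus_commute)
    thus "1 \<in> W" using d by (auto simp: W_def r_def)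
    fix v assume v: "v \<in> frontier W"
    have vW: "v \<in> W" using v closedW frontier_subset_closed by blast
    hence vd: "v \<noteq> of_real d" using d by (auto simp: W_def r_def)
    show "cmod (G v * b v ^ N) \<le> 1"
    proof (cases "v \<in> sphere 1 1")
      case True
      thus ?thesis using b_sphere[OF True vd] le[of v] by (simp add: norm_mult norm_power)
    next
      case False
      hence v2: "v \<in> sphere (of_real d) r" using front[OF v] by blast
      hence "cmod (G v) \<le> exp (- (8 * (L / d + 1)))" using neg by (auto simp: r_def not_le less_imp_le)
      also have "\<dots> \<le> exp (- (8 * real N))" using N by simp
      finally have "cmod (G v) * cmod (b v) ^ N \<le> exp (- (8 * real N)) * exp 8 ^ N"
        using b_small[OF v2] by (intro mult_mono power_mono) auto
      also have "\<dots> = 1" by (simp add: exp_of_nat_mult[symmetric] mult.commute flip: exp_add)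
      finally show ?thesis by (simp add: norm_mult norm_power)
    qed
  qed
  moreover have "b 1 = 1 / of_real (1 - d)" by (simp add: b_def)
  ultimately have "cmod (G 1) \<le> (1 - d) ^ N"
    using d by (simp add: norm_mult norm_power norm_divide field_simps del: of_real_diff)
  also have "\<dots> \<le> exp (- d) ^ N" using d exp_ge_add_one_self[of "- d"] by (intro power_mono) auto
  also have "\<dots> = exp (- (d * real N))" by (simp add: exp_of_nat_mult[symmetric] mult.commute)
  finally have "exp (- L) \<le> exp (- (d * real N))" using ge by linarith
  hence "d * real N \<le> L" by simp
  thus False using N(1) d by (simp add: field_simps)
qed

text \<open>In the closed right half plane the argument of \<open>v\<close> is at most
  \<open>pi / 2\<close> in modulus, so that of the power is at most \<open>p * (pi / 2)\<close>.
  Both signs of \<open>a\<close> occur: the positive one for the map to the Stolz angle, the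
  negative one for the majorant.\<close>

lemma Re_powr_ge:
  fixes v :: complex and a :: real
  assumes "Re v \<ge> 0" "\<bar>a\<bar> \<le> p" "p \<le> 1"
  shows "Re (v powr of_real a) \<ge> cos (p * (pi / 2)) * cmod v powr a"
proof (cases "v = 0")
  case False
  have "v powr of_real a = exp (of_real a * Ln v)"
    using False by (simp add: powr_def)
  hence "Re (v powr of_real a) = cmod v powr a * cos (a * Im (Ln v))"
    using False by (simp add: Re_exp powr_def)
  also have "\<dots> = cmod v powr a * cos \<bar>a * Im (Ln v)\<bar>" by simp
  also have "\<dots> \<ge> cmod v powr a * cos (p * (pi / 2))"
  proof (intro mult_left_mono cos_monotone_0_pi_le)
    have "\<bar>Im (Ln v)\<bar> \<le> pi / 2" using Re_Ln_pos_le[OF False] assms by simp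
    thus "\<bar>a * Im (Ln v)\<bar> \<le> p * (pi / 2)"
      using assms unfolding abs_mult by (intro mult_mono) auto
    show "p * (pi / 2) \<le> pi" using assms by (simp add: mult_left_le_one_le) 
  qed auto
  finally show ?thesis by (simp add: mult.commute)
qed auto

section \<open>The map of the disc with centre 1 into a Stolz angle\<close>

lemma cball_one_Re_nonneg:
  fixes v :: complex
  assumes "v \<in> cball 1 1"
  shows "Re v \<ge> 0" and "cmod v \<le> 2"
proof -
  have v: "cmod (1 - v) \<le> 1" using assms by (simp add: dist_norm)
  show "Re v \<ge> 0" using v complex_Re_le_cmod[of "1 - v"] by simp
  show "cmod v \<le> 2" using v norm_triangle_ineq4[of 1 "1 - v"] by simp
qed

lemma ball_one_not_nonpos_Reals:
  fixes v :: complex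
  assumes "v \<in> ball 1 1"
  shows "v \<notin> \<real>\<^sub>\<le>\<^sub>0"
proof -
  have "Re (1 - v) < 1"
    using assms complex_Re_le_cmod[of "1 - v"] by (simp add: dist_norm)
  thus ?thesis by (auto simp: complex_nonpos_Reals_iff)
qed

text \<open>In the expansion of the squared modulus the linear term is at least
  \<open>2 * c * \<kappa> * y\<close>, with \<open>y = cmod v powr p\<close>. The quadratic term
  \<open>(c * y)\<^sup>2\<close> takes away at most half of it, because
  \<open>c * y \<le> 2 * c \<le> \<kappa>\<close>. So the image stays away from the unit circle by a
  multiple of \<open>cmod v powr p\<close>.\<close>

lemma cmod_stolz_map_le:
  fixes v :: complex and c p :: real
  assumes p: "0 < p" "p < 1" and c: "0 < c" "2 * c \<le> cos (p * (pi / 2))" and v: "v \<in> cball 1 1"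
  shows "cmod (1 - of_real c * v powr of_real p) \<le> 1 - c * cos (p * (pi / 2)) / 2 * cmod v powr p"
proof -
  define \<kappa> where "\<kappa> = cos (p * (pi / 2))"
  define y where "y = cmod v powr p"
  define w where "w = v powr of_real p"
  have \<kappa>: "\<kappa> \<le> 1" "\<kappa> > 0" using c by (auto simp: \<kappa>_def)
  have y: "0 \<le> y" "y \<le> 2"
  proof -
    have "y \<le> 2 powr p"
      unfolding y_def using cball_one_Re_nonneg(2)[OF v] p by (intro powr_mono2) auto
    also have "\<dots> \<le> 2 powr 1" using p by (intro powr_mono) auto
    finally show "y \<le> 2" by simp
  qed (simp add: y_def)
  have norm_w: "cmod w = y" unfolding w_def y_def by (simp add: norm_powr_real_powr')
  have Re_w: "Re w \<ge> \<kappa> * y"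
    using Re_powr_ge[OF cball_one_Re_nonneg(1)[OF v], of p p] p by (simp add: w_def y_def \<kappa>_def)
  have "(cmod (1 - of_real c * w))\<^sup>2 = 1 - 2 * c * Re w + c\<^sup>2 * (cmod w)\<^sup>2"
    unfolding cmod_power2 by (simp add: power2_eq_square algebra_simps)
  also have "\<dots> \<le> 1 - 2 * c * (\<kappa> * y) + c * y * (c * y)"
    using Re_w c norm_w by (simp add: power2_eq_square mult_ac)
  also have "\<dots> \<le> 1 - 2 * c * (\<kappa> * y) + c * y * \<kappa>"
  proof -
    have "c * y \<le> c * 2" using y c by (intro mult_left_mono) auto
    hence "c * y \<le> \<kappa>" using c unfolding \<kappa>_def by linarith
    hence "c * y * (c * y) \<le> c * y * \<kappa>" using c y by (intro mult_left_mono) auto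
    thus ?thesis by linarith
  qed
  also have "\<dots> = 1 - c * \<kappa> * y" by (simp add: algebra_simps)
  also have "\<dots> \<le> (1 - c * \<kappa> / 2 * y)\<^sup>2"
    using zero_le_power2[of "c * \<kappa> / 2 * y"] by (simp add: power2_eq_square algebra_simps)
  finally have "(cmod (1 - of_real c * w))\<^sup>2 \<le> (1 - c * \<kappa> / 2 * y)\<^sup>2" .
  moreover have "0 \<le> 1 - c * \<kappa> / 2 * y"
  proof -
    have "c * \<kappa> * y \<le> 1 / 2 * 1 * 2"
      using c \<kappa> y unfolding \<kappa>_def[symmetric] by (intro mult_mono) auto
    thus ?thesis by simp
  qed
  ultimately show ?thesis unfolding w_def y_def \<kappa>_def by (rule power2_le_imp_le)
qed

text \<open>On the disc of radius \<open>d / 100\<close> the derivative of the power is at most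
  \<open>100 / 99 * d powr (p - 1)\<close>. The resulting factor \<open>1 / 99\<close> is below
  \<open>1 / 64\<close>, the closeness that the local estimate for \<open>A\<close> on a disc of
  radius \<open>\<delta> / 2\<close> demands.\<close>

lemma cmod_powr_diff_le:
  fixes v :: complex and d p :: real
  assumes p: "0 < p" "p < 1" and d: "d > 0" and v: "dist (of_real d) v = d / 100"
  shows "cmod (v powr of_real p - of_real (d powr p)) \<le> d powr p / 64"
proof -
  define S where "S = cball (complex_of_real d) (d / 100)"
  have Re: "99 / 100 * d \<le> Re w" if "w \<in> S" for w
    using that complex_Re_le_cmod[of "of_real d - w"] by (simp add: S_def dist_norm)
  have "cmod (v powr of_real p - of_real d powr of_real p) \<le> (100 / 99 * d powr (p - 1)) * cmod (v - of_real d)"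
  proof (rule field_differentiable_bound[where S = S and f' = "\<lambda>w. of_real p * w powr (of_real p - 1)"])
    fix w assume w: "w \<in> S"
    have pos: "Re w > 0" using Re[OF w] d by linarith
    hence "w \<notin> \<real>\<^sub>\<le>\<^sub>0" by (auto simp: complex_nonpos_Reals_iff)
    thus "((\<lambda>v. v powr of_real p) has_field_derivative of_real p * w powr (of_real p - 1)) (at w within S)"
      by (intro has_field_derivative_at_within[OF has_field_derivative_powr])
    have "cmod (w powr (of_real p - 1)) = cmod w powr (p - 1)"
      using norm_powr_real_powr'[of "of_real (p - 1)" w] by simp
    also have "\<dots> \<le> (99 / 100 * d) powr (p - 1)"
      using p d Re[OF w] complex_Re_le_cmod[of w] by (intro powr_mono2') auto
    also have "\<dots> = (99 / 100) powr (p - 1) * d powr (p - 1)" using d by (intro powr_mult)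
    also have "\<dots> \<le> (99 / 100) powr (- 1) * d powr (p - 1)"
      using p by (intro mult_right_mono powr_mono') auto
    also have "\<dots> = 100 / 99 * d powr (p - 1)" by (simp add: powr_minus)
    finally have "cmod (w powr (of_real p - 1)) \<le> 100 / 99 * d powr (p - 1)" .
    moreover have "p * cmod (w powr (of_real p - 1)) \<le> 1 * cmod (w powr (of_real p - 1))"
      using p by (intro mult_right_mono) auto
    ultimately show "cmod (of_real p * w powr (of_real p - 1)) \<le> 100 / 99 * d powr (p - 1)"
      using p by (simp add: norm_mult)
  qed (use v d in \<open>auto simp: S_def\<close>)
  also have "cmod (v - of_real d) = d / 100"
    using v by (simp add: dist_norm norm_minus_commute)
  also have "100 / 99 * d powr (p - 1) * (d / 100) = 1 / 99 * d powr p"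
    using d by (simp add: powr_diff)
  also have "\<dots> \<le> d powr p / 64" by simp
  finally show ?thesis using d by (simp add: powr_of_real)
qed

text \<open>Only finitely many moduli of zeros occur in a compact disc, so some radius and a band
  below it avoid them. A band rather than a circle is required since the reference point has modulus
  \<open>(1 - \<delta>) * (1 - c)\<close>, which moves with \<open>\<delta>\<close>.\<close>

lemma exists_zero_free_annulus:
  fixes f :: "complex \<Rightarrow> complex" and b :: real
  assumes f: "f holomorphic_on \<D>" and nz: "\<exists>z\<in>\<D>. f z \<noteq> 0" and b: "0 < b" "b < 1"
  obtains c e m where "0 < c" "c < b" "0 < e" "0 < m"
    "\<And>z. \<lbrakk>1 - c - e \<le> cmod z; cmod z \<le> 1 - c\<rbrakk> \<Longrightarrow> m \<le> cmod (f z)"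
proof (cases "f constant_on \<D>")
  case True
  then obtain a where a: "\<And>z. z \<in> \<D> \<Longrightarrow> f z = a" unfolding constant_on_def by blast
  show ?thesis
    by (rule that[of "b / 2" 1 "cmod a"]) (use a nz b in auto)
next
  case False
  define Z where "Z = cmod ` {z \<in> cball 0 (1 - b / 2). f z = 0}"
  have "finite Z"
    unfolding Z_def
    by (intro finite_imageI holomorphic_compact_finite_zeros[OF f open_ball connected_ball]) (use b False in auto)
  moreover have "infinite {1 - b<..<1 - b / 2}" using b by (simp add: infinite_Ioo)
  ultimately have "\<not> {1 - b<..<1 - b / 2} \<subseteq> Z" using finite_subset by blast
  then obtain r where r: "1 - b < r" "r < 1 - b / 2" "r \<notin> Z" by (meson greaterThanLessThan_iff subsetI)
  obtain e where e: "e > 0" "\<And>x. x \<in> Z \<Longrightarrow> x \<noteq> r \<Longrightarrow> e \<le> dist r x"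
    using finite_set_avoid[OF \<open>finite Z\<close>, of r] by blast
  define S where "S = {z. r - e / 2 \<le> cmod z \<and> cmod z \<le> r}"
  have "S = cball 0 r \<inter> {z. r - e / 2 \<le> cmod z}" by (auto simp: S_def)
  moreover have "closed {z::complex. r - e / 2 \<le> cmod z}" by (intro closed_Collect_le continuous_intros)
  ultimately have compact: "compact S" by (simp add: compact_Int_closed)
  have ne: "S \<noteq> {}"
  proof -
    have "complex_of_real r \<in> S" using r e b by (simp add: S_def)
    thus ?thesis by blast
  qed
  have "continuous_on S (\<lambda>z. cmod (f z))"
    by (intro continuous_intros continuous_on_subset[OF holomorphic_on_imp_continuous_on[OF f]])
      (use r b in \<open>auto simp: S_def\<close>)
  then obtain w where w: "w \<in> S" "\<And>z. z \<in> S \<Longrightarrow> cmod (f w) \<le> cmod (f z)"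
    using continuous_attains_inf[OF compact ne] by blast
  have "f w \<noteq> 0"
  proof
    assume "f w = 0"
    hence "cmod w \<in> Z" unfolding Z_def using w(1) r by (intro imageI) (auto simp: S_def)
    moreover have "cmod w \<noteq> r" using calculation r by auto
    ultimately have "e \<le> dist r (cmod w)" by (intro e)
    thus False using w(1) e(1) by (simp add: S_def dist_real_def)
  qed
  show ?thesis
    by (rule that[of "1 - r" "e / 2" "cmod (f w)"]) (use r b e w \<open>f w \<noteq> 0\<close> in \<open>auto simp: S_def\<close>)
qed

text \<open>
  Along the Stolz angle with vertex \<open>(1 - \<delta>) * \<zeta>\<close>, the bound for \<open>ln \<bar>f\<bar>\<close> becomes
  \<open>K * \<bar>\<tau> + v\<bar> powr - p\<close> with \<open>t = \<tau> powr p\<close>, and this is dominated by the real part of a holomorphic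
  function because \<open>p < 1\<close>. The majorant has size \<open>t powr (1 - s)\<close> at the centre \<open>v = 1\<close>, so the
  comparison with a Blaschke factor costs only a factor \<open>1 / d\<close>.
\<close>
lemma exists_point_solution_lower_bound:
  fixes f :: "complex \<Rightarrow> complex" and p s B \<delta> t c m d :: real
  assumes f: "f holomorphic_on \<D>" and p: "0 < p" "p < 1" and s: "s \<ge> 1" and B: "B > 0"
    and c: "0 < c" "2 * c \<le> cos (p * (pi / 2))" and \<delta>: "0 < \<delta>" "\<delta> < 1" and t: "0 < t" "t \<le> 1"
    and \<zeta>: "cmod \<zeta> = 1" and m: "0 < m" "m \<le> cmod (f (of_real (1 - \<delta>) * \<zeta> * (1 - of_real c)))"
    and d: "0 < d" "d \<le> 1 / 2"
    and le: "\<And>z. cmod z \<le> 1 - \<delta> \<Longrightarrow> cmod (f z) \<le> exp (B * (t + 1 - cmod z) powr - s)"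
  defines "\<kappa> \<equiv> cos (p * (pi / 2))"
  defines "K \<equiv> B * (c * \<kappa> / 2) powr - s / \<kappa> * t powr (1 - s)"
  obtains v where "dist (of_real d) v = d / 100"
    "cmod (f (of_real (1 - \<delta>) * \<zeta> * (1 - of_real c * v powr of_real p))) \<ge> exp (- (8 * ((K + \<bar>ln m\<bar>) / d + 1)))"
proof -
  define c1 where "c1 = c * \<kappa> / 2"
  define \<tau> where "\<tau> = t powr (1 / p)"
  define Z where "Z v = of_real (1 - \<delta>) * \<zeta> * (1 - of_real c * v powr of_real p)" for v
  define H where "H v = (of_real \<tau> + v) powr of_real (- p)" for v :: complex
  \<comment> \<open>\<open>K * Re (H v)\<close> is the harmonic majorant of
    \<open>ln (cmod (f (Z v)))\<close>; dividing by the corresponding exponential makes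
    \<open>G\<close> bounded by 1.\<close>
  define G where "G v = f (Z v) * exp (- of_real K * H v)" for v
  have \<kappa>: "0 < \<kappa>" "\<kappa> \<le> 1" using c by (auto simp: \<kappa>_def)
  have c1: "0 < c1" "c1 \<le> 1"
  proof -
    show "0 < c1" using c \<kappa> by (simp add: c1_def)
    have "c * \<kappa> \<le> 1 * 1" using c \<kappa> unfolding \<kappa>_def[symmetric] by (intro mult_mono) auto
    thus "c1 \<le> 1" by (simp add: c1_def)
  qed
  have \<tau>: "\<tau> > 0" "\<tau> powr p = t" using t p by (auto simp: \<tau>_def powr_powr)
  have K: "K > 0" using B c1 \<kappa> t by (simp add: K_def flip: c1_def)
  have shifted: "Re (of_real \<tau> + v) \<ge> \<tau>" "cmod (of_real \<tau> + v) \<ge> \<tau>" if "v \<in> cball 1 1" for v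
  proof -
    show *: "Re (of_real \<tau> + v) \<ge> \<tau>" using cball_one_Re_nonneg(1)[OF that] by simp
    show "cmod (of_real \<tau> + v) \<ge> \<tau>" using * complex_Re_le_cmod[of "of_real \<tau> + v"] by linarith
  qed
  have Z_norm: "cmod (Z v) = (1 - \<delta>) * cmod (1 - of_real c * v powr of_real p)" for v
    using \<zeta> \<delta> norm_of_real[of "1 - \<delta>", where 'a = complex] by (simp add: Z_def norm_mult del: of_real_diff)
  have Z_le: "cmod (Z v) \<le> 1 - \<delta>" "cmod (Z v) \<le> 1 - c1 * cmod v powr p" if "v \<in> cball 1 1" for v
  proof -
    define a where "a = cmod (1 - of_real c * v powr of_real p)"
    have a: "a \<le> 1 - c1 * cmod v powr p"
      using cmod_stolz_map_le[OF p c that] by (simp add: a_def c1_def \<kappa>_def)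
    have "0 \<le> c1 * cmod v powr p" using c1 by simp
    hence "a \<le> 1" using a by linarith
    hence "(1 - \<delta>) * a \<le> (1 - \<delta>) * 1" using \<delta> by (intro mult_left_mono) auto
    moreover have "(1 - \<delta>) * a \<le> 1 * a" using \<delta> by (intro mult_right_mono) (auto simp: a_def)
    ultimately show "cmod (Z v) \<le> 1 - \<delta>" "cmod (Z v) \<le> 1 - c1 * cmod v powr p"
      using a by (auto simp: Z_norm a_def)
  qed
  have f_le: "cmod (f (Z v)) \<le> exp (K * Re (H v))" if v: "v \<in> cball 1 1" for v
  proof -
    define y where "y = cmod (of_real \<tau> + v)"
    have y: "y \<ge> \<tau>" using shifted[OF v] by (simp add: y_def)
    have "c1 * y powr p \<le> c1 * (\<tau> + cmod v) powr p"
      using c1 p \<tau> y norm_triangle_ineq[of "of_real \<tau>" v] unfolding y_def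
      by (intro mult_left_mono powr_mono2) auto
    also have "\<dots> \<le> c1 * (t + cmod v powr p)"
      using powr_add_le[of \<tau> "cmod v" p] \<tau> p c1 by (intro mult_left_mono) auto
    also have "\<dots> \<le> t + c1 * cmod v powr p"
      using c1 t mult_right_mono[of c1 1 t] by (simp add: distrib_left)
    also have "\<dots> \<le> t + 1 - cmod (Z v)" using Z_le(2)[OF v] by simp
    finally have base: "c1 * y powr p \<le> t + 1 - cmod (Z v)" .
    have "(t + 1 - cmod (Z v)) powr - s \<le> (c1 * y powr p) powr - s"
      using base c1 y \<tau> s by (intro powr_mono2') auto
    \<comment> \<open>Only the power with exponent \<open>- p\<close> is kept, since its real part
      majorises its modulus up to \<open>\<kappa>\<close>. The remaining exponent
      \<open>p * (1 - s)\<close> is not positive, so that factor is largest at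
      \<open>y = \<tau>\<close>, where it equals \<open>t powr (1 - s)\<close>.\<close>
    also have "\<dots> = c1 powr - s * (y powr - p * y powr (p * (1 - s)))"
    proof -
      have "p * - s = - p + p * (1 - s)" by (simp add: algebra_simps)
      hence "(y powr p) powr - s = y powr - p * y powr (p * (1 - s))"
        by (simp only: powr_powr powr_add)
      thus ?thesis by (simp add: powr_mult)
    qed
    also have "\<dots> \<le> c1 powr - s * (y powr - p * \<tau> powr (p * (1 - s)))"
      using y \<tau> p s by (intro mult_left_mono powr_mono2') (auto intro: mult_nonneg_nonpos)
    also have "\<tau> powr (p * (1 - s)) = t powr (1 - s)"
      using \<tau>(2) by (simp add: powr_powr[symmetric])
    finally have "B * (t + 1 - cmod (Z v)) powr - s \<le> B * (c1 powr - s * (y powr - p * t powr (1 - s)))"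
      using B by (intro mult_left_mono) auto
    also have "\<dots> = K * (\<kappa> * y powr - p)"
      using \<kappa> by (simp add: K_def flip: c1_def)
    also have "\<dots> \<le> K * Re (H v)"
      using Re_powr_ge[of "of_real \<tau> + v" "- p" p] shifted(1)[OF v] \<tau> p K
      by (intro mult_left_mono) (auto simp: H_def y_def \<kappa>_def)
    finally have "exp (B * (t + 1 - cmod (Z v)) powr - s) \<le> exp (K * Re (H v))" by simp
    thus ?thesis using le[OF Z_le(1)[OF v]] by linarith
  qed
  have norm_G: "cmod (G v) = cmod (f (Z v)) * exp (- (K * Re (H v)))" for v
    by (simp add: G_def norm_mult)
  have Z_hol: "Z holomorphic_on ball 1 1"
    unfolding Z_def by (intro holomorphic_intros) (use ball_one_not_nonpos_Reals in auto)
  have Z_cont: "continuous_on (cball 1 1) Z"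
    unfolding Z_def by (intro continuous_intros) (use cball_one_Re_nonneg p in auto)
  have Z_disc: "Z ` cball 1 1 \<subseteq> \<D>" using Z_le(1) \<delta> by fastforce
  have shifted_not_nonpos: "of_real \<tau> + v \<notin> \<real>\<^sub>\<le>\<^sub>0" if "v \<in> cball 1 1" for v :: complex
    using shifted(1)[OF that] \<tau> by (auto simp: complex_nonpos_Reals_iff)
  have G_hol: "G holomorphic_on ball 1 1"
    unfolding G_def H_def
  proof (intro holomorphic_intros)
    show "(\<lambda>v. f (Z v)) holomorphic_on ball 1 1"
      by (rule holomorphic_on_compose_gen[unfolded o_def, OF Z_hol f])
        (use Z_disc ball_subset_cball[of "1 :: complex" 1] in blast)
  qed (use shifted_not_nonpos ball_subset_cball[of "1 :: complex" 1] in blast)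
  have G_cont: "continuous_on (cball 1 1) G"
    unfolding G_def H_def
  proof (intro continuous_intros)
    show "continuous_on (cball 1 1) (\<lambda>v. f (Z v))"
      by (rule continuous_on_compose2[OF holomorphic_on_imp_continuous_on[OF f] Z_cont Z_disc])
  qed (use shifted \<tau> in \<open>force+\<close>)
  have "\<exists>v. dist (of_real d) v = d / 100 \<and> cmod (G v) \<ge> exp (- (8 * ((K + \<bar>ln m\<bar>) / d + 1)))"
  proof (rule exists_point_lower_bound[OF G_hol G_cont _ _ _ d])
    fix v :: complex assume v: "v \<in> cball 1 1"
    have "cmod (G v) \<le> exp (K * Re (H v)) * exp (- (K * Re (H v)))"
      unfolding norm_G using f_le[OF v] by (intro mult_right_mono) auto
    thus "cmod (G v) \<le> 1" by (simp flip: exp_add)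
  next
    \<comment> \<open>At the centre the majorant is at most \<open>K\<close>, and \<open>f\<close>
      is at least \<open>m\<close> there.\<close>
    have "Re (H 1) \<le> cmod (H 1)" by (rule complex_Re_le_cmod)
    also have "\<dots> = (\<tau> + 1) powr - p"
      using \<tau> norm_powr_real_powr'[of "of_real (- p)" "of_real \<tau> + 1"] norm_of_real[of "\<tau> + 1", where 'a = complex]
      by (simp add: H_def)
    also have "\<dots> \<le> 1" using \<tau> p powr_mono2'[of "- p" 1 "\<tau> + 1"] by simp
    finally have "K * Re (H 1) \<le> K" using K mult_left_mono[of "Re (H 1)" 1 K] by simp
    moreover have "- \<bar>ln m\<bar> \<le> ln m" by simp
    ultimately have "exp (- (K + \<bar>ln m\<bar>)) \<le> exp (ln m) * exp (- (K * Re (H 1)))"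
      unfolding exp_add[symmetric] exp_le_cancel_iff by linarith
    also have "\<dots> \<le> cmod (G 1)"
      unfolding norm_G using m by (intro mult_right_mono) (auto simp: Z_def)
    finally show "exp (- (K + \<bar>ln m\<bar>)) \<le> cmod (G 1)" .
  qed (use K in auto)
  then obtain v where v: "dist (of_real d) v = d / 100" "cmod (G v) \<ge> exp (- (8 * ((K + \<bar>ln m\<bar>) / d + 1)))"
    by blast
  have vd: "cmod (of_real d - v) = d / 100" using v(1) by (simp add: dist_norm)
  have "v \<in> cball 1 1"
  proof -
    have "cmod (1 - of_real d :: complex) = 1 - d"
      using d norm_of_real[of "1 - d", where 'a = complex] by simp
    thus ?thesis
      using vd d norm_triangle_ineq[of "1 - of_real d" "of_real d - v"] by (simp add: dist_norm)
  qed
  \<comment> \<open>The exponential factor in \<open>G\<close> has modulus at most 1 on the disc, so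
    a lower bound for \<open>G\<close> is one for \<open>f\<close> as well.\<close>
  hence "Re (of_real \<tau> + v) \<ge> 0" using shifted(1) \<tau> by fastforce
  hence "Re (H v) \<ge> \<kappa> * cmod (of_real \<tau> + v) powr - p"
    using Re_powr_ge[of "of_real \<tau> + v" "- p" p] p by (simp add: H_def \<kappa>_def)
  moreover have "0 \<le> \<kappa> * cmod (of_real \<tau> + v) powr - p" using \<kappa> by simp
  ultimately have "K * Re (H v) \<ge> 0" using K by simp
  hence "cmod (f (Z v)) * exp (- (K * Re (H v))) \<le> cmod (f (Z v)) * 1" by (intro mult_left_mono) auto
  hence "exp (- (8 * ((K + \<bar>ln m\<bar>) / d + 1))) \<le> cmod (f (Z v))" using v(2) norm_G[of v] by linarith
  thus ?thesis using that[of v] v(1) by (simp add: Z_def)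
qed

text \<open>For \<open>z\<close> of modulus \<open>(1 - \<delta>)\<^sup>2\<close>, the Stolz angle
  with vertex at radius \<open>1 - \<delta>\<close> supplies a point \<open>z1\<close> within
  \<open>\<delta> / 64\<close> of \<open>z\<close> at which \<open>f\<close> is not too small. The
  growth bound controls \<open>f\<close> on the disc of radius \<open>\<delta> / 2\<close> around
  \<open>z1\<close>, and the local estimate applies there.\<close>

lemma coefficient_bound_from_growth:
  fixes k :: nat and A f :: "complex \<Rightarrow> complex" and p s B :: real
  assumes f: "f holomorphic_on \<D>" and A: "A holomorphic_on \<D>"
    and ode: "\<And>z. z \<in> \<D> \<Longrightarrow> (deriv ^^ k) f z + A z * f z = 0"
    and nz: "\<exists>z\<in>\<D>. f z \<noteq> 0" and p: "0 < p" "p < 1" and s: "s \<ge> 1" and B: "B > 0"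
  obtains C \<delta>0 where "C > 0" "0 < \<delta>0" "\<delta>0 < 1"
    "\<And>\<delta> t z. \<lbrakk>0 < \<delta>; \<delta> < \<delta>0; \<delta> \<le> t; t \<le> 1;
       \<And>w. cmod w \<le> 1 - \<delta> \<Longrightarrow> cmod (f w) \<le> exp (B * (t + 1 - cmod w) powr - s);
       cmod z = (1 - \<delta>)\<^sup>2\<rbrakk> \<Longrightarrow>
       cmod (A z) \<le> C * (t powr ((1 - s) / p) * \<delta> powr (- 1 - 1 / p\<^sup>2)) ^ k"
proof -
  define \<kappa> where "\<kappa> = cos (p * (pi / 2))"
  have \<kappa>: "0 < \<kappa>" "\<kappa> \<le> 1"
  proof -
    have "p * (pi / 2) < 1 * (pi / 2)" using p by (intro mult_strict_right_mono) auto
    thus "0 < \<kappa>" unfolding \<kappa>_def using p by (intro cos_gt_zero) auto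
  qed (simp add: \<kappa>_def)
  obtain c e m where c: "0 < c" "c < \<kappa> / 2" and e: "0 < e" and m: "0 < m"
    and m_le: "\<And>z. \<lbrakk>1 - c - e \<le> cmod z; cmod z \<le> 1 - c\<rbrakk> \<Longrightarrow> m \<le> cmod (f z)"
    using exists_zero_free_annulus[OF f nz, of "\<kappa> / 2"] \<kappa> by auto
  obtain C3 where C3: "C3 > 0" and local_bound:
    "\<And>S f A z1 z R M. \<lbrakk>open S; cball z1 R \<subseteq> S; R > 0; M \<ge> 1; f holomorphic_on S; A holomorphic_on S;
       \<And>z. z \<in> S \<Longrightarrow> (deriv ^^ k) f z + A z * f z = 0;
       \<And>z. z \<in> cball z1 R \<Longrightarrow> cmod (f z) \<le> exp M; cmod (f z1) \<ge> exp (- M); dist z1 z \<le> R / 32\<rbrakk> \<Longrightarrow>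
       cmod (A z) \<le> C3 * (M powr (1 / p) / R) ^ k"
    using coefficient_bound_near_point[OF p, of k] by blast
  define K0 where "K0 = B * (c * \<kappa> / 2) powr - s / \<kappa>"
  have K0: "K0 > 0" using B c \<kappa> by (simp add: K0_def)
  \<comment> \<open>The first summand lets \<open>M\<close> dominate the exponent of the lower bound
    for \<open>f\<close>, the second the exponent of its upper bound.\<close>
  define C2 where "C2 = 8 * (K0 + \<bar>ln m\<bar> + 1) + B / c"
  have C2: "C2 \<ge> 8" using K0 B c by (simp add: C2_def)
  define C where "C = C3 * (2 * C2 powr (1 / p) * c powr (1 / p\<^sup>2)) ^ k"
  \<comment> \<open>The bound \<open>1 / 6\<close> keeps the local disc within radius
    \<open>1 - \<delta>\<close>, \<open>e\<close> keeps the reference point in the zero-free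
    annulus, and \<open>c / 2\<close> ensures \<open>d \<le> 1 / 2\<close>.\<close>
  define \<delta>0 where "\<delta>0 = min (1 / 6) (min e (c / 2))"
  have c': "2 * c \<le> cos (p * (pi / 2))" using c by (simp add: \<kappa>_def)
  show ?thesis
  proof (rule that[of C \<delta>0])
    show "C > 0" using C3 C2 c by (simp add: C_def)
    show "0 < \<delta>0" "\<delta>0 < 1" using e c by (auto simp: \<delta>0_def)
    fix \<delta> t :: real and z :: complex
    assume \<delta>: "0 < \<delta>" "\<delta> < \<delta>0" and t: "\<delta> \<le> t" "t \<le> 1" and z: "cmod z = (1 - \<delta>)\<^sup>2"
      and le: "\<And>w. cmod w \<le> 1 - \<delta> \<Longrightarrow> cmod (f w) \<le> exp (B * (t + 1 - cmod w) powr - s)"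
    have \<delta>_small: "\<delta> < 1 / 6" "\<delta> < e" "\<delta> < c / 2" using \<delta> by (auto simp: \<delta>0_def)
    have t0: "t > 0" using \<delta> t by simp
    \<comment> \<open>Solves \<open>c * d powr p = \<delta>\<close>, so that \<open>v = d\<close> is
      mapped exactly to \<open>z\<close>.\<close>
    define d where "d = (\<delta> / c) powr (1 / p)"
    have d_pow: "d powr p = \<delta> / c" using p \<delta> c by (simp add: d_def powr_powr)
    have d0: "0 < d" using \<delta> c by (simp add: d_def)
    have d_le: "d \<le> \<delta> / c"
    proof -
      have "d \<le> (\<delta> / c) powr 1"
        unfolding d_def using \<delta> \<delta>_small c p by (intro powr_mono') auto
      thus ?thesis using \<delta> c by simp
    qed
    have "\<delta> / c \<le> 1 / 2" using \<delta>_small c by (simp add: pos_divide_le_eq)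
    hence d_half: "d \<le> 1 / 2" using d_le by linarith
    define \<zeta> where "\<zeta> = sgn z"
    have "z \<noteq> 0" using z \<delta>_small by auto
    hence \<zeta>: "cmod \<zeta> = 1" by (simp add: \<zeta>_def norm_sgn)
    have z_eq: "z = of_real ((1 - \<delta>)\<^sup>2) * \<zeta>"
      using \<open>z \<noteq> 0\<close> by (simp add: \<zeta>_def sgn_div_norm scaleR_conv_of_real flip: z)
    have m': "m \<le> cmod (f (of_real (1 - \<delta>) * \<zeta> * (1 - of_real c)))"
    proof (rule m_le)
      have "cmod (of_real (1 - \<delta>) * \<zeta> * (1 - of_real c)) = (1 - \<delta>) * (1 - c)"
        using \<zeta> \<delta>_small c \<kappa> norm_of_real[of "1 - \<delta>", where 'a = complex] norm_of_real[of "1 - c", where 'a = complex]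
        by (simp add: norm_mult)
      moreover have "(1 - \<delta>) * (1 - c) \<le> 1 * (1 - c)" using \<delta> c \<kappa> by (intro mult_right_mono) auto
      moreover have "\<delta> * (1 - c) \<le> \<delta> * 1" using \<delta> c by (intro mult_left_mono) auto
      ultimately show "1 - c - e \<le> cmod (of_real (1 - \<delta>) * \<zeta> * (1 - of_real c))"
        "cmod (of_real (1 - \<delta>) * \<zeta> * (1 - of_real c)) \<le> 1 - c"
        using \<delta>_small by (auto simp: algebra_simps)
    qed
    obtain v where v: "dist (of_real d) v = d / 100" and f_ge:
      "cmod (f (of_real (1 - \<delta>) * \<zeta> * (1 - of_real c * v powr of_real p)))
         \<ge> exp (- (8 * ((K0 * t powr (1 - s) + \<bar>ln m\<bar>) / d + 1)))"
      using exists_point_solution_lower_bound[OF f p s B c(1) c' \<delta>(1) _ t0 t(2) \<zeta> m m' d0 d_half le] \<delta>_small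
      unfolding K0_def \<kappa>_def by auto
    define z1 where "z1 = of_real (1 - \<delta>) * \<zeta> * (1 - of_real c * v powr of_real p)"
    define M where "M = C2 * t powr (1 - s) / d"
    have t_pow: "1 \<le> t powr (1 - s)" using t0 t s powr_mono2'[of "1 - s" t 1] by simp
    have td: "1 \<le> t powr (1 - s) / d" using t_pow d0 d_half by (simp add: field_simps)
    have M: "M \<ge> 1"
      using mult_mono[of 1 C2 1 "t powr (1 - s) / d"] C2 td by (simp add: M_def)
    have le1: "8 * ((K0 * t powr (1 - s) + \<bar>ln m\<bar>) / d + 1) \<le> M"
    proof -
      have "\<bar>ln m\<bar> * 1 \<le> \<bar>ln m\<bar> * t powr (1 - s)" by (intro mult_left_mono t_pow) auto
      hence "(K0 * t powr (1 - s) + \<bar>ln m\<bar>) / d \<le> (K0 + \<bar>ln m\<bar>) * t powr (1 - s) / d"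
        using d0 by (intro divide_right_mono) (auto simp: algebra_simps)
      hence le0: "(K0 * t powr (1 - s) + \<bar>ln m\<bar>) / d \<le> (K0 + \<bar>ln m\<bar>) * (t powr (1 - s) / d)"
        by simp
      have "8 * ((K0 * t powr (1 - s) + \<bar>ln m\<bar>) / d + 1) \<le> 8 * ((K0 + \<bar>ln m\<bar> + 1) * (t powr (1 - s) / d))"
      proof -
        have "8 * (X + 1) \<le> 8 * ((a + 1) * y)" if "X \<le> a * y" "1 \<le> y" for X a y :: real
          using that by (simp add: distrib_right)
        from this[OF le0 td] show ?thesis .
      qed
      also have "\<dots> \<le> C2 * (t powr (1 - s) / d)"
        using mult_right_mono[of "8 * (K0 + \<bar>ln m\<bar> + 1)" C2 "t powr (1 - s) / d"] B c td
        unfolding C2_def by (simp only: mult.assoc) simp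
      finally show ?thesis by (simp add: M_def)
    qed
    \<comment> \<open>Here \<open>\<delta> \<le> t\<close> enters:
      \<open>c * d \<le> \<delta> \<le> t\<close> allows \<open>1 / t\<close> to be replaced by
      \<open>1 / (c * d)\<close>.\<close>
    have le2: "B * t powr - s \<le> M"
    proof -
      have "B * t powr - s = B * t powr (1 - s) * (1 / t)"
        using t0 by (simp add: powr_diff powr_minus field_simps)
      also have "\<dots> \<le> B * t powr (1 - s) * (1 / (c * d))"
      proof (intro mult_left_mono divide_left_mono)
        show "c * d \<le> t" using d_le t c by (simp add: field_simps)
      qed (use B t0 c d0 in auto)
      also have "\<dots> = B / c * (t powr (1 - s) / d)" by simp
      also have "\<dots> \<le> C2 * (t powr (1 - s) / d)"
        using K0 td by (intro mult_right_mono) (auto simp: C2_def)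
      finally show ?thesis by (simp add: M_def)
    qed
    have z_eq': "z = of_real (1 - \<delta>) * \<zeta> * (1 - of_real c * of_real (d powr p))"
      unfolding z_eq d_pow using c by (simp add: power2_eq_square)
    have dist_z: "dist z1 z \<le> \<delta> / 2 / 32"
    proof -
      have "z1 - z = of_real (1 - \<delta>) * \<zeta> * (of_real c * (of_real (d powr p) - v powr of_real p))"
        unfolding z1_def z_eq' by (simp add: algebra_simps)
      hence "dist z1 z = (1 - \<delta>) * (c * cmod (v powr of_real p - of_real (d powr p)))"
        using \<zeta> \<delta>_small c norm_of_real[of "1 - \<delta>", where 'a = complex]
        by (simp add: dist_norm norm_mult norm_minus_commute del: of_real_diff)
      also have "\<dots> \<le> 1 * (c * (d powr p / 64))"
        using cmod_powr_diff_le[OF p d0 v] \<delta> \<delta>_small c by (intro mult_mono) auto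
      also have "\<dots> = \<delta> / 2 / 32" using d_pow c by simp
      finally show ?thesis .
    qed
    \<comment> \<open>Squaring the radius moves \<open>z\<close> inwards from the circle of radius
      \<open>1 - \<delta>\<close> by \<open>\<delta> * (1 - \<delta>)\<close>, which leaves room for
      the disc of radius \<open>\<delta> / 2\<close> and the displacement of
      \<open>z1\<close>.\<close>
    have ball_sub: "cmod w \<le> 1 - \<delta>" if "w \<in> cball z1 (\<delta> / 2)" for w
    proof -
      have "cmod w \<le> dist z1 w + dist z1 z + cmod z"
        using norm_triangle_ineq[of "w - z" z] dist_triangle[of w z z1] by (simp add: dist_norm norm_minus_commute)
      also have "\<dots> \<le> \<delta> / 2 + \<delta> / 2 / 32 + (1 - \<delta>)\<^sup>2" using that dist_z z by simp
      also have "\<dots> \<le> 1 - \<delta>"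
      proof -
        have "\<delta> * \<delta> \<le> \<delta> * (1 / 6)" using \<delta> \<delta>_small by (intro mult_left_mono) auto
        thus ?thesis using \<delta> by (simp add: power2_eq_square algebra_simps)
      qed
      finally show ?thesis .
    qed
    have "cmod (A z) \<le> C3 * (M powr (1 / p) / (\<delta> / 2)) ^ k"
    proof (rule local_bound[OF open_ball _ _ M f A ode])
      show "cball z1 (\<delta> / 2) \<subseteq> \<D>" using ball_sub \<delta> by fastforce
      show "0 < \<delta> / 2" using \<delta> by simp
      show "dist z1 z \<le> \<delta> / 2 / 32" by (rule dist_z)
      show "exp (- M) \<le> cmod (f z1)"
      proof -
        have "exp (- M) \<le> exp (- (8 * ((K0 * t powr (1 - s) + \<bar>ln m\<bar>) / d + 1)))"
          using le1 by simp
        thus ?thesis using f_ge unfolding z1_def by linarith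
      qed
      fix w assume "w \<in> cball z1 (\<delta> / 2)"
      hence w: "cmod w \<le> 1 - \<delta>" by (rule ball_sub)
      have "(t + 1 - cmod w) powr - s \<le> t powr - s"
        using w \<delta> t0 s by (intro powr_mono2') auto
      hence "B * (t + 1 - cmod w) powr - s \<le> B * t powr - s" using B by (intro mult_left_mono) auto
      hence "exp (B * (t + 1 - cmod w) powr - s) \<le> exp M" using le2 by simp
      thus "cmod (f w) \<le> exp M" using le[OF w] by linarith
    qed
    \<comment> \<open>The exponent \<open>1 / p\<^sup>2\<close> arises because \<open>d\<close> is
      the power \<open>1 / p\<close> of \<open>\<delta> / c\<close> and \<open>M\<close> is raised
      to \<open>1 / p\<close> again.\<close>
    also have "M powr (1 / p) / (\<delta> / 2)
        = 2 * C2 powr (1 / p) * c powr (1 / p\<^sup>2) * (t powr ((1 - s) / p) * \<delta> powr (- 1 - 1 / p\<^sup>2))"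
    proof -
      have "M powr (1 / p) = C2 powr (1 / p) * (t powr (1 - s)) powr (1 / p) / d powr (1 / p)"
        using C2 by (simp add: M_def powr_divide powr_mult)
      moreover have "(t powr (1 - s)) powr (1 / p) = t powr ((1 - s) / p)" by (simp add: powr_powr)
      moreover have "d powr (1 / p) = \<delta> powr (1 / p\<^sup>2) / c powr (1 / p\<^sup>2)"
        using \<delta> c by (simp add: d_def powr_powr powr_divide power2_eq_square)
      moreover have "\<delta> powr (- 1 - 1 / p\<^sup>2) = 1 / (\<delta> * \<delta> powr (1 / p\<^sup>2))"
        using \<delta> by (simp add: powr_diff powr_minus field_simps)
      ultimately show ?thesis by (simp add: mult_ac)
    qed
    finally show "cmod (A z) \<le> C * (t powr ((1 - s) / p) * \<delta> powr (- 1 - 1 / p\<^sup>2)) ^ k"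
      by (simp add: C_def power_mult_distrib mult.assoc)
  qed
qed

lemma ln_le_iff_le_exp: "0 < x \<Longrightarrow> ln x \<le> y \<longleftrightarrow> x \<le> exp y" for x y :: real
  by (metis exp_le_cancel_iff exp_ln)

text \<open>The shift \<open>t\<close> is chosen with \<open>t powr s = \<delta> powr l\<close>, so
  that the global bound of exponent \<open>s\<close> and the bound at one radius merge;
  \<open>l \<le> s\<close> gives \<open>\<delta> \<le> t\<close>. As \<open>p\<close> tends to 1 the
  exponent tends to \<open>k * (2 + (s - 1) * l / s)\<close>.\<close>

lemma coefficient_bound_at_radius:
  fixes k :: nat and A f :: "complex \<Rightarrow> complex" and p s B l :: real
  assumes f: "f holomorphic_on \<D>" and A: "A holomorphic_on \<D>"
    and ode: "\<And>z. z \<in> \<D> \<Longrightarrow> (deriv ^^ k) f z + A z * f z = 0"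
    and nz: "\<exists>z\<in>\<D>. f z \<noteq> 0" and p: "0 < p" "p < 1" and s: "s \<ge> 1" and l: "0 < l" "l \<le> s"
    and le: "\<And>z. z \<in> \<D> \<Longrightarrow> cmod (f z) \<le> exp (B * (1 - cmod z) powr - s)"
  obtains C \<delta>0 where "C > 0" "0 < \<delta>0" "\<delta>0 < 1"
    "\<And>\<delta> z. \<lbrakk>0 < \<delta>; \<delta> < \<delta>0; \<And>w. cmod w \<le> 1 - \<delta> \<Longrightarrow> cmod (f w) \<le> exp (\<delta> powr - l);
       cmod z = (1 - \<delta>)\<^sup>2\<rbrakk> \<Longrightarrow>
       cmod (A z) \<le> C * \<delta> powr - (real k * (1 + 1 / p\<^sup>2 + (s - 1) * l / (s * p)))"
proof -
  define D where "D = max B 1"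
  have D: "D \<ge> 1" "D \<ge> B" by (auto simp: D_def)
  have "D * 2 powr s > 0" using D by simp
  from coefficient_bound_from_growth[OF f A ode nz p s this]
  obtain C \<delta>0 where C: "C > 0" and \<delta>0: "0 < \<delta>0" "\<delta>0 < 1" and bound:
    "\<And>\<delta> t z. \<lbrakk>0 < \<delta>; \<delta> < \<delta>0; \<delta> \<le> t; t \<le> 1;
       \<And>w. cmod w \<le> 1 - \<delta> \<Longrightarrow> cmod (f w) \<le> exp (D * 2 powr s * (t + 1 - cmod w) powr - s);
       cmod z = (1 - \<delta>)\<^sup>2\<rbrakk> \<Longrightarrow>
       cmod (A z) \<le> C * (t powr ((1 - s) / p) * \<delta> powr (- 1 - 1 / p\<^sup>2)) ^ k"
    by blast
  show ?thesis
  proof (rule that[OF C \<delta>0])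
    fix \<delta> :: real and z
    assume \<delta>: "0 < \<delta>" "\<delta> < \<delta>0" and z: "cmod z = (1 - \<delta>)\<^sup>2"
      and le_at: "\<And>w. cmod w \<le> 1 - \<delta> \<Longrightarrow> cmod (f w) \<le> exp (\<delta> powr - l)"
    define t where "t = \<delta> powr (l / s)"
    have t_ge: "\<delta> \<le> t"
      using powr_mono'[of "l / s" 1 \<delta>] \<delta> \<delta>0 l s by (simp add: t_def)
    have t_le: "t \<le> 1" using \<delta> \<delta>0 l s by (auto simp: t_def powr_le1)
    have t_pow: "t powr - s = \<delta> powr - l" using s by (simp add: t_def powr_powr)
    have "cmod (A z) \<le> C * (t powr ((1 - s) / p) * \<delta> powr (- 1 - 1 / p\<^sup>2)) ^ k"
    proof (rule bound[OF \<delta> t_ge t_le _ z])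
      fix w assume w: "cmod w \<le> 1 - \<delta>"
      show "cmod (f w) \<le> exp (D * 2 powr s * (t + 1 - cmod w) powr - s)"
      proof (cases "f w = 0")
        case False
        have "ln (cmod (f w)) \<le> D * 2 powr s * (t + (1 - cmod w)) powr - s"
        proof (rule le_powr_add_of_le_powr)
          have "ln (cmod (f w)) \<le> B * (1 - cmod w) powr - s"
            using le[of w] w \<delta> False by (simp add: ln_le_iff_le_exp)
          also have "\<dots> \<le> D * (1 - cmod w) powr - s" using D by (intro mult_right_mono) auto
          finally show "ln (cmod (f w)) \<le> D * (1 - cmod w) powr - s" .
          have "ln (cmod (f w)) \<le> 1 * t powr - s"
            using le_at[OF w] False t_pow by (simp add: ln_le_iff_le_exp)
          also have "\<dots> \<le> D * t powr - s" using D by (intro mult_right_mono) auto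
          finally show "ln (cmod (f w)) \<le> D * t powr - s" .
        qed (use w \<delta> t_ge D s in auto)
        thus ?thesis using False by (simp add: ln_le_iff_le_exp algebra_simps)
      qed auto
    qed
    also have "(t powr ((1 - s) / p) * \<delta> powr (- 1 - 1 / p\<^sup>2)) ^ k
        = \<delta> powr - (real k * (1 + 1 / p\<^sup>2 + (s - 1) * l / (s * p)))"
    proof -
      have "t powr ((1 - s) / p) * \<delta> powr (- 1 - 1 / p\<^sup>2)
          = \<delta> powr (l / s * ((1 - s) / p) + (- 1 - 1 / p\<^sup>2))"
        unfolding t_def powr_powr powr_add ..
      also have "l / s * ((1 - s) / p) + (- 1 - 1 / p\<^sup>2) = - (1 + 1 / p\<^sup>2 + (s - 1) * l / (s * p))"
        by (simp add: algebra_simps diff_divide_distrib)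
      finally show ?thesis
        using \<delta> by (simp only: powr_realpow[symmetric] powr_powr powr_gt_zero mult.commute mult_minus_right)
    qed
    finally show "cmod (A z) \<le> C * \<delta> powr - (real k * (1 + 1 / p\<^sup>2 + (s - 1) * l / (s * p)))" .
  qed
qed

subsection \<open>Growth indicators\<close>

lemma log_plus_nonneg: "log_plus x \<ge> 0"
  by (simp add: log_plus_def)

lemma le_exp_log_plus:
  assumes "0 \<le> x"
  shows "x \<le> exp (log_plus x)"
proof (cases "x = 0")
  case False
  hence "x = exp (ln x)" using assms by simp
  also have "\<dots> \<le> exp (log_plus x)" using False by (simp add: log_plus_def)
  finally show ?thesis .
qed simp

lemma log_plus_le:
  assumes "0 \<le> x" "x \<le> exp y" "0 \<le> y"
  shows "log_plus x \<le> y"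
  using assms by (auto simp: log_plus_def ln_le_iff_le_exp)

section \<open>Maximum modulus and bounds on the whole disc\<close>

lemma max_modulus_le:
  assumes "0 \<le> r" "\<And>z. cmod z = r \<Longrightarrow> cmod (g z) \<le> B"
  shows "max_modulus r g \<le> B"
proof -
  have "complex_of_real r \<in> sphere 0 r" using assms(1) by simp
  hence "sphere (0 :: complex) r \<noteq> {}" by blast
  thus ?thesis unfolding max_modulus_def using assms by (intro cSUP_least) auto
qed

text \<open>The maximum principle passes from the circle to the disc, so information at a single
  radius provides the bounds on discs that the growth estimates assume.\<close>

lemma le_max_modulus:
  assumes g: "g holomorphic_on \<D>" and r: "r < 1" and z: "cmod z \<le> r"
  shows "cmod (g z) \<le> max_modulus r g"
proof (rule maximum_modulus_frontier[where S = "cball 0 r" and f = g])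
  have sub: "cball 0 r \<subseteq> \<D>" using r by auto
  have cont: "continuous_on (cball 0 r) g"
    by (rule continuous_on_subset[OF holomorphic_on_imp_continuous_on[OF g] sub])
  thus "continuous_on (closure (cball 0 r)) g" by simp
  show "g holomorphic_on interior (cball 0 r)"
    by (rule holomorphic_on_subset[OF g]) (use sub interior_subset in blast)
  fix w assume "w \<in> frontier (cball (0 :: complex) r)"
  hence w: "w \<in> sphere 0 r" by simp
  have "compact ((\<lambda>z. cmod (g z)) ` sphere 0 r)"
    by (intro compact_continuous_image continuous_intros continuous_on_subset[OF cont]) auto
  thus "cmod (g w) \<le> max_modulus r g"
    unfolding max_modulus_def using w by (intro cSUP_upper) (auto intro: compact_imp_bounded bounded_imp_bdd_above)
qed (use z in auto)

lemma max_modulus_nonneg: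
  assumes "g holomorphic_on \<D>" "0 \<le> r" "r < 1"
  shows "0 \<le> max_modulus r g"
  using order_trans[OF norm_ge_zero le_max_modulus[of g r 0]] assms by simp

text \<open>The hypothesis at one radius \<open>r2\<close> bounds \<open>u\<close> on the whole
  inner disc, where the power is at least 1; enlarging the constant absorbs this value.\<close>

lemma bound_extends_to_disc:
  fixes u :: "complex \<Rightarrow> real"
  assumes "\<And>r. \<lbrakk>r1 < r; r < 1\<rbrakk> \<Longrightarrow> \<forall>z. cmod z \<le> r \<longrightarrow> u z \<le> (1 - r) powr - y"
    and "r1 < 1" "y \<ge> 0"
  obtains D where "\<And>z. z \<in> \<D> \<Longrightarrow> u z \<le> D * (1 - cmod z) powr - y"
proof
  define r2 where "r2 = (max r1 0 + 1) / 2"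
  have r2: "r1 < r2" "r2 < 1" "0 \<le> r2" using assms by (auto simp: r2_def)
  fix z assume "z \<in> \<D>"
  hence z: "cmod z < 1" by simp
  show "u z \<le> max 1 ((1 - r2) powr - y) * (1 - cmod z) powr - y"
  proof (cases "cmod z \<le> r2")
    case True
    have "1 \<le> (1 - cmod z) powr - y" using z assms powr_mono2'[of "- y" "1 - cmod z" 1] by simp
    hence "(1 - r2) powr - y * 1 \<le> max 1 ((1 - r2) powr - y) * (1 - cmod z) powr - y"
      by (intro mult_mono) auto
    moreover have "u z \<le> (1 - r2) powr - y" using assms(1)[of r2] r2 True by blast
    ultimately show ?thesis by linarith
  next
    case False
    hence "r1 < cmod z" using r2 by simp
    hence "u z \<le> 1 * (1 - cmod z) powr - y" using assms(1)[of "cmod z"] z by simp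
    also have "\<dots> \<le> max 1 ((1 - r2) powr - y) * (1 - cmod z) powr - y"
      by (intro mult_right_mono) auto
    finally show ?thesis .
  qed
qed

section \<open>Upper and lower limits of logarithmic ratios\<close>

lemma filterlim_ln_at_left_1: "filterlim (\<lambda>r::real. ln (1 / (1 - r))) at_top (at_left 1)"
proof (rule filterlim_compose[OF ln_at_top])
  have "((\<lambda>r::real. 1 - r) \<longlongrightarrow> 0) (at_left 1)" by (auto intro!: tendsto_eq_intros)
  moreover have "eventually (\<lambda>r::real. 1 - r > 0) (at_left 1)"
    unfolding eventually_at_left_field by (intro exI[of _ 0]) auto
  ultimately have "filterlim (\<lambda>r::real. inverse (1 - r)) at_top (at_left 1)"
    by (rule filterlim_inverse_at_top)
  thus "filterlim (\<lambda>r::real. 1 / (1 - r)) at_top (at_left 1)" by (simp add: inverse_eq_divide)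
qed

lemma eventually_at_left_1_in_unit: "eventually (\<lambda>r::real. 0 < r \<and> r < 1) (at_left 1)"
  unfolding eventually_at_left_field by (intro exI[of _ 0]) auto

text \<open>Since the logarithm tends to infinity, any gain in slope absorbs an additive constant;
  multiplicative constants in the growth estimates therefore do not affect the indicators.\<close>

lemma eventually_ln_compare:
  fixes C x y :: real
  assumes "x < y"
  shows "eventually (\<lambda>r. C + x * ln (1 / (1 - r)) < y * ln (1 / (1 - r))) (at_left 1)"
proof -
  have "eventually (\<lambda>r::real. C / (y - x) < ln (1 / (1 - r))) (at_left 1)"
    using filterlim_ln_at_left_1 by (simp add: filterlim_at_top_dense)
  thus ?thesis
    by eventually_elim (use assms in \<open>simp add: pos_divide_less_eq algebra_simps\<close>)
qed

lemma Limsup_ratio_le: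
  assumes "eventually (\<lambda>r. \<phi> r \<le> C + x * ln (1 / (1 - r))) (at_left 1)"
  shows "Limsup (at_left 1) (\<lambda>r. ereal (\<phi> r / ln (1 / (1 - r)))) \<le> ereal x"
proof (subst Limsup_le_iff, intro allI impI)
  fix y :: ereal assume "ereal x < y"
  from ereal_dense2[OF this] obtain y' where y': "x < y'" "ereal y' < y" by auto
  show "eventually (\<lambda>r. ereal (\<phi> r / ln (1 / (1 - r))) < y) (at_left 1)"
    using assms eventually_ln_compare[OF y'(1), of C] filterlim_ln_at_left_1[unfolded filterlim_at_top_dense, rule_format, of 0]
  proof eventually_elim
    case (elim r)
    hence "\<phi> r / ln (1 / (1 - r)) < y'" by (simp add: pos_divide_less_eq)
    hence "ereal (\<phi> r / ln (1 / (1 - r))) < ereal y'" by simp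
    thus ?case using y'(2) by (rule order.strict_trans)
  qed
qed

lemma Liminf_ratio_greaterD:
  assumes "ereal y < Liminf (at_left 1) (\<lambda>r. ereal (\<phi> r / ln (1 / (1 - r))))"
  shows "eventually (\<lambda>r. y * ln (1 / (1 - r)) < \<phi> r) (at_left 1)"
  using less_LiminfD[OF assms] filterlim_ln_at_left_1[unfolded filterlim_at_top_dense, rule_format, of 0]
  by eventually_elim (simp add: pos_less_divide_eq)

lemma Limsup_ratio_lessD:
  assumes "Limsup (at_left 1) (\<lambda>r. ereal (\<phi> r / ln (1 / (1 - r)))) < ereal y"
  shows "eventually (\<lambda>r. \<phi> r < y * ln (1 / (1 - r))) (at_left 1)"
  using Limsup_lessD[OF assms] filterlim_ln_at_left_1[unfolded filterlim_at_top_dense, rule_format, of 0]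
  by eventually_elim (simp add: pos_divide_less_eq)

text \<open>A lower limit gives information only along radii accumulating at 1, so the conclusion is
  \<open>frequently\<close> where the upper limit gives \<open>eventually\<close>.\<close>

lemma Liminf_ratio_lessD:
  assumes "Liminf (at_left 1) (\<lambda>r. ereal (\<phi> r / ln (1 / (1 - r)))) < ereal y"
  shows "frequently (\<lambda>r. \<phi> r < y * ln (1 / (1 - r))) (at_left 1)"
proof (rule ccontr)
  assume "\<not> ?thesis"
  hence "eventually (\<lambda>r. y * ln (1 / (1 - r)) \<le> \<phi> r) (at_left 1)"
    by (simp add: not_frequently not_less)
  hence "eventually (\<lambda>r. ereal y \<le> ereal (\<phi> r / ln (1 / (1 - r)))) (at_left 1)"
    using filterlim_ln_at_left_1[unfolded filterlim_at_top_dense, rule_format, of 0]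
    by eventually_elim (simp add: pos_le_divide_eq)
  from Liminf_bounded[OF this] show False using assms by simp
qed

lemma Liminf_ratio_le:
  assumes "frequently (\<lambda>r. \<phi> r \<le> C + x * ln (1 / (1 - r))) (at_left 1)"
  shows "Liminf (at_left 1) (\<lambda>r. ereal (\<phi> r / ln (1 / (1 - r)))) \<le> ereal x"
proof (rule ccontr)
  assume "\<not> ?thesis"
  hence "ereal x < Liminf (at_left 1) (\<lambda>r. ereal (\<phi> r / ln (1 / (1 - r))))" by simp
  from ereal_dense2[OF this]
  obtain y where y: "x < y" "ereal y < Liminf (at_left 1) (\<lambda>r. ereal (\<phi> r / ln (1 / (1 - r))))"
    by auto
  have "eventually (\<lambda>r. \<not> \<phi> r \<le> C + x * ln (1 / (1 - r))) (at_left 1)"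
    using Liminf_ratio_greaterD[OF y(2)] eventually_ln_compare[OF y(1), of C]
    by eventually_elim simp
  thus False using assms by (simp add: frequently_def)
qed

lemma exp_times_ln: "r < 1 \<Longrightarrow> exp (y * ln (1 / (1 - r))) = (1 - r) powr - y" for r y :: real
  by (simp add: powr_def ln_div)

lemma filterlim_at_left_1I:
  assumes "(g \<longlongrightarrow> 1) (at_left 1)" "eventually (\<lambda>r. g r < 1) (at_left 1)"
  shows "filterlim g (at_left (1 :: real)) (at_left (1 :: real))"
  unfolding filterlim_at using assms by (auto elim: eventually_mono)

text \<open>The growth of \<open>f\<close> at radius \<open>r\<close> controls \<open>A\<close> at
  radius \<open>r\<^sup>2\<close>. Squaring and the square root both preserve the approach to 1 from
  the left. One direction transfers \<open>eventually\<close> for the degree; the other, after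
  negation, transfers \<open>frequently\<close> for the lower degree.\<close>

lemma eventually_at_left_1_power2:
  "eventually (\<lambda>r. P (r\<^sup>2)) (at_left 1) \<longleftrightarrow> eventually P (at_left (1 :: real))"
proof
  assume ev: "eventually (\<lambda>r. P (r\<^sup>2)) (at_left 1)"
  have "(sqrt \<longlongrightarrow> 1) (at_left 1)" by (auto intro!: tendsto_eq_intros)
  moreover have "eventually (\<lambda>r. sqrt r < 1) (at_left 1)"
    using eventually_at_left_1_in_unit by eventually_elim simp
  ultimately have "filterlim sqrt (at_left 1) (at_left 1)" by (intro filterlim_at_left_1I)
  with ev have "eventually (\<lambda>r. P ((sqrt r)\<^sup>2)) (at_left 1)" by (rule eventually_compose_filterlim)
  thus "eventually P (at_left 1)" using eventually_at_left_1_in_unit by eventually_elim simp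
next
  assume ev: "eventually P (at_left 1)"
  have "((\<lambda>r::real. r\<^sup>2) \<longlongrightarrow> 1) (at_left 1)" by (auto intro!: tendsto_eq_intros)
  moreover have "eventually (\<lambda>r::real. r\<^sup>2 < 1) (at_left 1)"
    using eventually_at_left_1_in_unit by eventually_elim (simp add: power_less_one_iff)
  ultimately have "filterlim (\<lambda>r::real. r\<^sup>2) (at_left 1) (at_left 1)" by (intro filterlim_at_left_1I)
  with ev show "eventually (\<lambda>r. P (r\<^sup>2)) (at_left 1)" by (rule eventually_compose_filterlim)
qed

lemma growth_orders_nonneg:
  shows "0 \<le> lower_growth_order f" and "lower_growth_order f \<le> growth_order f"
proof -
  have "eventually (\<lambda>r. 0 \<le> ereal (log_plus (log_plus (max_modulus r f)) / ln (1 / (1 - r)))) (at_left 1)"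
    using eventually_at_left_1_in_unit
    by eventually_elim (auto intro!: divide_nonneg_nonneg log_plus_nonneg)
  thus "0 \<le> lower_growth_order f" unfolding lower_growth_order_def by (rule Liminf_bounded)
  show "lower_growth_order f \<le> growth_order f"
    unfolding lower_growth_order_def growth_order_def by (intro Liminf_le_Limsup) simp
qed

section \<open>Comparison of the growth indicators of the coefficient and the solution\<close>

lemma max_modulus_le_powr:
  assumes g: "g holomorphic_on \<D>" and r: "0 < r" "r < 1"
    and less: "log_plus (max_modulus r g) < y * ln (1 / (1 - r))"
  shows "max_modulus r g \<le> (1 - r) powr - y"
proof -
  have "max_modulus r g \<le> exp (log_plus (max_modulus r g))"
    using g r by (intro le_exp_log_plus max_modulus_nonneg) auto
  also have "\<dots> \<le> (1 - r) powr - y"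
    using less r by (simp flip: exp_times_ln)
  finally show ?thesis .
qed

lemma max_modulus_le_exp_powr:
  assumes g: "g holomorphic_on \<D>" and r: "0 < r" "r < 1"
    and less: "log_plus (log_plus (max_modulus r g)) < y * ln (1 / (1 - r))"
  shows "max_modulus r g \<le> exp ((1 - r) powr - y)"
proof -
  have "max_modulus r g \<le> exp (log_plus (max_modulus r g))"
    using g r by (intro le_exp_log_plus max_modulus_nonneg) auto
  also have "log_plus (max_modulus r g) \<le> exp (log_plus (log_plus (max_modulus r g)))"
    by (intro le_exp_log_plus log_plus_nonneg)
  also have "\<dots> \<le> (1 - r) powr - y"
    using less r by (simp flip: exp_times_ln)
  finally show ?thesis by simp
qed

text \<open>The constant is independent of the radius, so the same estimate yields the order with
  \<open>\<mu>\<close> near the degree of \<open>A\<close>, for all \<open>r\<close> near 1, and the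
  lower order with \<open>\<mu>\<close> near the lower degree, for a sequence of radii.\<close>

lemma log_log_growth_bound:
  fixes k :: nat and A f :: "complex \<Rightarrow> complex" and q \<mu> :: real
  assumes k: "k \<ge> 1" and f: "f holomorphic_on \<D>" and A: "A holomorphic_on \<D>"
    and ode: "\<And>z. z \<in> \<D> \<Longrightarrow> (deriv ^^ k) f z + A z * f z = 0"
    and q: "q > real k" "growth_degree A < ereal q" and \<mu>: "\<mu> > 0"
  obtains C where "\<And>r. \<lbrakk>0 < r; r < 1; max_modulus r A \<le> (1 - r) powr - \<mu>\<rbrakk> \<Longrightarrow>
    log_plus (log_plus (max_modulus r f)) \<le> C + (q / real k - 1) * \<mu> / q * ln (1 / (1 - r))"
proof -
  define s where "s = q / real k"
  have s: "s > 1" "real k * s = q" using q k by (auto simp: s_def)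
  have "eventually (\<lambda>r. log_plus (max_modulus r A) < q * ln (1 / (1 - r))) (at_left 1)"
    using q(2) unfolding growth_degree_def by (rule Limsup_ratio_lessD)
  hence "eventually (\<lambda>r. max_modulus r A \<le> (1 - r) powr - q) (at_left 1)"
    using eventually_at_left_1_in_unit by eventually_elim (auto intro: max_modulus_le_powr[OF A])
  then obtain r1 where r1: "r1 < 1" "\<And>r. \<lbrakk>r1 < r; r < 1\<rbrakk> \<Longrightarrow> max_modulus r A \<le> (1 - r) powr - q"
    unfolding eventually_at_left_field by blast
  have "\<forall>z. cmod z \<le> r \<longrightarrow> cmod (A z) \<le> (1 - r) powr - q" if "r1 < r" "r < 1" for r
    using le_max_modulus[OF A that(2)] r1(2)[OF that] by (meson order_trans)
  then obtain D where D: "\<And>z. z \<in> \<D> \<Longrightarrow> cmod (A z) \<le> D * (1 - cmod z) powr - q"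
    using bound_extends_to_disc[of r1 "\<lambda>z. cmod (A z)" q] r1 q by auto
  obtain K C where K: "K > 0" and C: "C > 0" and bound:
    "\<And>\<delta> z. \<lbrakk>0 < \<delta>; \<delta> < 1; \<And>w. cmod w \<le> 1 - \<delta> \<Longrightarrow> cmod (A w) \<le> \<delta> powr - \<mu>; cmod z \<le> 1 - \<delta>\<rbrakk>
       \<Longrightarrow> cmod (f z) \<le> K * exp (C * \<delta> powr - ((s - 1) * \<mu> / (real k * s)))"
    using solution_growth_at_radius[OF k f ode s(1) \<mu>, of D] D unfolding s(2) by blast
  define x where "x = (s - 1) * \<mu> / q"
  have x: "x \<ge> 0" using s q \<mu> by (simp add: x_def)
  define C' where "C' = \<bar>ln K\<bar> + C"
  have C': "C' > 0" using C by (simp add: C'_def)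
  show ?thesis
  proof (rule that[of "\<bar>ln C'\<bar>"])
    fix r :: real assume r: "0 < r" "r < 1" and le: "max_modulus r A \<le> (1 - r) powr - \<mu>"
    have pow: "1 \<le> (1 - r) powr - x" using powr_mono2'[of "- x" "1 - r" 1] r x by simp
    have f_le: "max_modulus r f \<le> exp (C' * (1 - r) powr - x)"
    proof (rule max_modulus_le)
      fix z :: complex assume z: "cmod z = r"
      have "cmod (f z) \<le> K * exp (C * (1 - r) powr - x)"
        unfolding x_def s(2)[symmetric]
        by (rule bound) (use r z le le_max_modulus[OF A r(2)] in \<open>auto intro: order_trans\<close>)
      also have "\<dots> = exp (ln K + C * (1 - r) powr - x)" using K by (simp add: exp_add)
      also have "\<dots> \<le> exp (C' * (1 - r) powr - x)"
      proof -
        have "ln K * 1 \<le> \<bar>ln K\<bar> * (1 - r) powr - x"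
          by (intro mult_mono pow) auto
        thus ?thesis by (simp add: C'_def distrib_right)
      qed
      finally show "cmod (f z) \<le> exp (C' * (1 - r) powr - x)" .
    qed (use r in auto)
    have "log_plus (max_modulus r f) \<le> C' * (1 - r) powr - x"
      by (intro log_plus_le f_le max_modulus_nonneg f) (use r C' in auto)
    also have "\<dots> = exp (ln C' + x * ln (1 / (1 - r)))"
      using C' r by (simp add: exp_add exp_times_ln)
    also have "\<dots> \<le> exp (\<bar>ln C'\<bar> + x * ln (1 / (1 - r)))" by simp
    finally have "log_plus (log_plus (max_modulus r f)) \<le> \<bar>ln C'\<bar> + x * ln (1 / (1 - r))"
      by (intro log_plus_le[OF log_plus_nonneg]) (use x r in \<open>auto intro!: add_nonneg_nonneg mult_nonneg_nonneg\<close>)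
    thus "log_plus (log_plus (max_modulus r f)) \<le> \<bar>ln C'\<bar> + (q / real k - 1) * \<mu> / q * ln (1 / (1 - r))"
      by (simp add: x_def s_def)
  qed
qed

text \<open>The counterpart in the opposite direction: any radius at which \<open>f\<close> is small
  makes \<open>A\<close> small at the squared radius, with constants independent of that
  radius.\<close>

lemma log_degree_bound:
  fixes k :: nat and A f :: "complex \<Rightarrow> complex" and p s l :: real
  assumes f: "f holomorphic_on \<D>" and A: "A holomorphic_on \<D>"
    and ode: "\<And>z. z \<in> \<D> \<Longrightarrow> (deriv ^^ k) f z + A z * f z = 0"
    and nz: "\<exists>z\<in>\<D>. f z \<noteq> 0" and p: "0 < p" "p < 1" and s: "s \<ge> 1" "growth_order f < ereal s"
    and l: "0 < l" "l \<le> s"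
  obtains C r0 where "r0 < 1"
    "\<And>r. \<lbrakk>r0 < r; r < 1; max_modulus r f \<le> exp ((1 - r) powr - l)\<rbrakk> \<Longrightarrow>
      log_plus (max_modulus (r\<^sup>2) A) \<le> C + real k * (1 + 1 / p\<^sup>2 + (s - 1) * l / (s * p)) * ln (1 / (1 - r\<^sup>2))"
proof -
  have "eventually (\<lambda>r. log_plus (log_plus (max_modulus r f)) < s * ln (1 / (1 - r))) (at_left 1)"
    using s(2) unfolding growth_order_def by (rule Limsup_ratio_lessD)
  hence "eventually (\<lambda>r. max_modulus r f \<le> exp ((1 - r) powr - s)) (at_left 1)"
    using eventually_at_left_1_in_unit by eventually_elim (auto intro: max_modulus_le_exp_powr[OF f])
  then obtain r1 where r1: "r1 < 1" "\<And>r. \<lbrakk>r1 < r; r < 1\<rbrakk> \<Longrightarrow> max_modulus r f \<le> exp ((1 - r) powr - s)"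
    unfolding eventually_at_left_field by blast
  have "\<forall>z. cmod z \<le> r \<longrightarrow> log_plus (cmod (f z)) \<le> (1 - r) powr - s" if "r1 < r" "r < 1" for r
    using le_max_modulus[OF f that(2)] r1(2)[OF that] by (auto intro!: log_plus_le intro: order_trans)
  then obtain B where B: "\<And>z. z \<in> \<D> \<Longrightarrow> log_plus (cmod (f z)) \<le> B * (1 - cmod z) powr - s"
    using bound_extends_to_disc[of r1 "\<lambda>z. log_plus (cmod (f z))" s] r1 s by auto
  have B': "cmod (f z) \<le> exp (B * (1 - cmod z) powr - s)" if "z \<in> \<D>" for z
    using le_exp_log_plus[of "cmod (f z)"] B[OF that] by (smt (verit) exp_le_cancel_iff norm_ge_zero)
  define E where "E = real k * (1 + 1 / p\<^sup>2 + (s - 1) * l / (s * p))"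
  have E: "E \<ge> 0" using p s l by (auto simp: E_def intro!: mult_nonneg_nonneg add_nonneg_nonneg)
  obtain C \<delta>0 where C: "C > 0" and \<delta>0: "0 < \<delta>0" "\<delta>0 < 1" and bound:
    "\<And>\<delta> z. \<lbrakk>0 < \<delta>; \<delta> < \<delta>0; \<And>w. cmod w \<le> 1 - \<delta> \<Longrightarrow> cmod (f w) \<le> exp (\<delta> powr - l);
       cmod z = (1 - \<delta>)\<^sup>2\<rbrakk> \<Longrightarrow> cmod (A z) \<le> C * \<delta> powr - E"
    using coefficient_bound_at_radius[OF f A ode nz p s(1) l B'] unfolding E_def by blast
  show ?thesis
  proof (rule that[of "1 - \<delta>0" "\<bar>ln C\<bar> + E * ln 2"])
    show "1 - \<delta>0 < 1" using \<delta>0 by simp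
    fix r :: real assume r: "1 - \<delta>0 < r" "r < 1" and le: "max_modulus r f \<le> exp ((1 - r) powr - l)"
    have r0: "0 < r" using r \<delta>0 by simp
    have r2: "r\<^sup>2 < 1" using r r0 by (simp add: power_less_one_iff)
    have "max_modulus (r\<^sup>2) A \<le> C * (1 - r) powr - E"
    proof (rule max_modulus_le)
      fix z :: complex assume z: "cmod z = r\<^sup>2"
      show "cmod (A z) \<le> C * (1 - r) powr - E"
        by (rule bound) (use r z le le_max_modulus[OF f r(2)] in \<open>auto intro: order_trans\<close>)
    qed simp
    also have "\<dots> \<le> C * (2 powr E * (1 - r\<^sup>2) powr - E)"
    proof -
      \<comment> \<open>The distances of \<open>r\<close> and \<open>r\<^sup>2\<close> from 1 are
        comparable, so changing from one to the other costs only the factor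
        \<open>2 powr E\<close>.\<close>
      have "1 - r\<^sup>2 \<le> 2 * (1 - r)"
        using zero_le_power2[of "1 - r"] by (simp add: power2_eq_square algebra_simps)
      hence "(2 * (1 - r)) powr - E \<le> (1 - r\<^sup>2) powr - E"
        using r2 E by (intro powr_mono2') auto
      hence "2 powr E * (2 * (1 - r)) powr - E \<le> 2 powr E * (1 - r\<^sup>2) powr - E"
        by (intro mult_left_mono) auto
      moreover have "2 powr E * (2 * (1 - r)) powr - E = (1 - r) powr - E"
        by (simp only: powr_mult) (simp add: powr_minus)
      ultimately have "(1 - r) powr - E \<le> 2 powr E * (1 - r\<^sup>2) powr - E" by (simp only:)
      thus ?thesis using C by (intro mult_left_mono) auto
    qed
    also have "\<dots> = exp (ln C + E * ln 2 + E * ln (1 / (1 - r\<^sup>2)))"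
      using C r2 by (simp add: exp_add exp_times_ln powr_def)
    also have "\<dots> \<le> exp (\<bar>ln C\<bar> + E * ln 2 + E * ln (1 / (1 - r\<^sup>2)))" by simp
    finally show "log_plus (max_modulus (r\<^sup>2) A) \<le> \<bar>ln C\<bar> + E * ln 2 +
        real k * (1 + 1 / p\<^sup>2 + (s - 1) * l / (s * p)) * ln (1 / (1 - r\<^sup>2))"
      unfolding E_def[symmetric]
      by (intro log_plus_le max_modulus_nonneg A)
        (use E r2 in \<open>auto intro!: add_nonneg_nonneg mult_nonneg_nonneg\<close>)
  qed
qed

text \<open>The degree and the lower degree are exceeded by an arbitrary \<open>e > 0\<close>, and
  \<open>e\<close> tends to 0 in the resulting exponents. With \<open>\<mu> = p2 + e\<close> the
  fraction collapses to the bound for the order.\<close>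

lemma growth_orders_upper:
  fixes k :: nat and A f :: "complex \<Rightarrow> complex" and p1 p2 :: real
  assumes k: "k \<ge> 1" and f: "f holomorphic_on \<D>" and A: "A holomorphic_on \<D>"
    and ode: "\<And>z. z \<in> \<D> \<Longrightarrow> (deriv ^^ k) f z + A z * f z = 0"
    and p2: "growth_degree A = ereal p2" "p2 > real k"
    and p1: "lower_growth_degree A = ereal p1" "p1 > 0"
  shows "growth_order f \<le> ereal (p2 / real k - 1)"
    and "lower_growth_order f \<le> ereal ((p2 / real k - 1) * p1 / p2)"
proof -
  have lim: "((\<lambda>e. ((p2 + e) / real k - 1) * (a + e) / (p2 + e)) \<longlongrightarrow> (p2 / real k - 1) * a / p2) (at_right 0)" for a
    using p2 k by (auto intro!: tendsto_eq_intros)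
  have ev: "eventually (\<lambda>e::real. 0 < e) (at_right 0)" by (simp add: eventually_at_right_less)
  have upper: "growth_order f \<le> ereal (((p2 + e) / real k - 1) * (p2 + e) / (p2 + e))" if e: "0 < e" for e
  proof -
    have q: "p2 + e > real k" "growth_degree A < ereal (p2 + e)" "p2 + e > 0" using p2 e by auto
    obtain C where C: "\<And>r. \<lbrakk>0 < r; r < 1; max_modulus r A \<le> (1 - r) powr - (p2 + e)\<rbrakk> \<Longrightarrow>
      log_plus (log_plus (max_modulus r f)) \<le> C + ((p2 + e) / real k - 1) * (p2 + e) / (p2 + e) * ln (1 / (1 - r))"
      using log_log_growth_bound[OF k f A ode q] by blast
    have "eventually (\<lambda>r. log_plus (max_modulus r A) < (p2 + e) * ln (1 / (1 - r))) (at_left 1)"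
      using q(2) unfolding growth_degree_def by (rule Limsup_ratio_lessD)
    hence "eventually (\<lambda>r. log_plus (log_plus (max_modulus r f))
        \<le> C + ((p2 + e) / real k - 1) * (p2 + e) / (p2 + e) * ln (1 / (1 - r))) (at_left 1)"
      using eventually_at_left_1_in_unit
      by eventually_elim (intro C max_modulus_le_powr[OF A], auto)
    thus ?thesis unfolding growth_order_def by (rule Limsup_ratio_le)
  qed
  have "((\<lambda>e. ereal (((p2 + e) / real k - 1) * (p2 + e) / (p2 + e))) \<longlongrightarrow> ereal ((p2 / real k - 1) * p2 / p2)) (at_right 0)"
    by (intro tendsto_ereal lim)
  from tendsto_lowerbound[OF this eventually_mono[OF ev upper]]
  have "growth_order f \<le> ereal ((p2 / real k - 1) * p2 / p2)" by simp
  thus "growth_order f \<le> ereal (p2 / real k - 1)" using p2 by simp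
  have lower: "lower_growth_order f \<le> ereal (((p2 + e) / real k - 1) * (p1 + e) / (p2 + e))" if e: "0 < e" for e
  proof -
    have q: "p2 + e > real k" "growth_degree A < ereal (p2 + e)" and \<mu>: "p1 + e > 0" using p1 p2 e by auto
    obtain C where C: "\<And>r. \<lbrakk>0 < r; r < 1; max_modulus r A \<le> (1 - r) powr - (p1 + e)\<rbrakk> \<Longrightarrow>
      log_plus (log_plus (max_modulus r f)) \<le> C + ((p2 + e) / real k - 1) * (p1 + e) / (p2 + e) * ln (1 / (1 - r))"
      using log_log_growth_bound[OF k f A ode q \<mu>] by blast
    have "lower_growth_degree A < ereal (p1 + e)" using p1 e by simp
    hence "frequently (\<lambda>r. log_plus (max_modulus r A) < (p1 + e) * ln (1 / (1 - r))) (at_left 1)"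
      unfolding lower_growth_degree_def by (rule Liminf_ratio_lessD)
    hence "frequently (\<lambda>r. log_plus (max_modulus r A) < (p1 + e) * ln (1 / (1 - r)) \<and> (0 < r \<and> r < 1)) (at_left 1)"
      using eventually_at_left_1_in_unit by (rule frequently_eventually_frequently)
    hence "frequently (\<lambda>r. log_plus (log_plus (max_modulus r f))
        \<le> C + ((p2 + e) / real k - 1) * (p1 + e) / (p2 + e) * ln (1 / (1 - r))) (at_left 1)"
      by (rule frequently_elim1) (intro C max_modulus_le_powr[OF A], auto)
    thus ?thesis unfolding lower_growth_order_def by (rule Liminf_ratio_le)
  qed
  have "((\<lambda>e. ereal (((p2 + e) / real k - 1) * (p1 + e) / (p2 + e))) \<longlongrightarrow> ereal ((p2 / real k - 1) * p1 / p2)) (at_right 0)"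
    by (intro tendsto_ereal lim)
  from tendsto_lowerbound[OF this eventually_mono[OF ev lower]]
  show "lower_growth_order f \<le> ereal ((p2 / real k - 1) * p1 / p2)" by simp
qed

text \<open>All losses are tied to one parameter: \<open>p = 1 - e\<close>,
  \<open>s = s0 + e\<close>, and \<open>l\<close> is \<open>s0 + e\<close> or \<open>l0 + e\<close>,
  with \<open>e\<close> tending to 0. An upper bound \<open>s0 \<ge> 1\<close> for the order takes
  the place of the order itself because the Stolz angle argument works with exponents of at least
  1.\<close>

lemma growth_degrees_upper:
  fixes k :: nat and A f :: "complex \<Rightarrow> complex" and s0 l0 :: real
  assumes f: "f holomorphic_on \<D>" and A: "A holomorphic_on \<D>"
    and ode: "\<And>z. z \<in> \<D> \<Longrightarrow> (deriv ^^ k) f z + A z * f z = 0"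
    and nz: "\<exists>z\<in>\<D>. f z \<noteq> 0" and s0: "s0 \<ge> 1" "growth_order f \<le> ereal s0"
    and l0: "lower_growth_order f = ereal l0" "0 \<le> l0" "l0 \<le> s0"
  shows "growth_degree A \<le> ereal (real k * (s0 + 1))"
    and "lower_growth_degree A \<le> ereal (real k * (2 + (s0 - 1) * l0 / s0))"
proof -
  define E where "E a e = real k * (1 + 1 / (1 - e)\<^sup>2 + (s0 + e - 1) * (a + e) / ((s0 + e) * (1 - e)))" for a e :: real
  have lim: "((\<lambda>e. ereal (E a e)) \<longlongrightarrow> ereal (real k * (2 + (s0 - 1) * a / s0))) (at_right 0)" for a
    unfolding E_def using s0 by (auto intro!: tendsto_eq_intros)
  have ev: "eventually (\<lambda>e::real. 0 < e \<and> e < 1) (at_right 0)"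
    by (intro eventually_conj eventually_at_right_less eventually_at_right_real[of 0 1, THEN eventually_mono]) auto
  have key: "\<exists>C r0. r0 < 1 \<and> (\<forall>r. r0 < r \<and> r < 1 \<and> max_modulus r f \<le> exp ((1 - r) powr - (a + e)) \<longrightarrow>
      log_plus (max_modulus (r\<^sup>2) A) \<le> C + E a e * ln (1 / (1 - r\<^sup>2)))"
    if e: "0 < e" "e < 1" and a: "0 \<le> a" "a \<le> s0" for a e
  proof -
    have p: "0 < 1 - e" "1 - e < 1" and s: "s0 + e \<ge> 1" "growth_order f < ereal (s0 + e)"
      and l: "0 < a + e" "a + e \<le> s0 + e"
      using s0 e a by (auto intro: le_less_trans)
    show ?thesis using log_degree_bound[OF f A ode nz p s l] unfolding E_def by metis
  qed
  have upper: "growth_degree A \<le> ereal (E s0 e)" if e: "0 < e" "e < 1" for e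
  proof -
    obtain C r0 where r0: "r0 < 1" and C: "\<And>r. \<lbrakk>r0 < r; r < 1; max_modulus r f \<le> exp ((1 - r) powr - (s0 + e))\<rbrakk> \<Longrightarrow>
      log_plus (max_modulus (r\<^sup>2) A) \<le> C + E s0 e * ln (1 / (1 - r\<^sup>2))"
      using key[OF e, of s0] s0 by auto
    have r0': "eventually (\<lambda>r. r0 < r) (at_left 1)"
      unfolding eventually_at_left_field using r0 by blast
    have "growth_order f < ereal (s0 + e)" using s0 e by (auto intro: le_less_trans)
    hence "eventually (\<lambda>r. log_plus (log_plus (max_modulus r f)) < (s0 + e) * ln (1 / (1 - r))) (at_left 1)"
      unfolding growth_order_def by (rule Limsup_ratio_lessD)
    hence "eventually (\<lambda>r. log_plus (max_modulus (r\<^sup>2) A) \<le> C + E s0 e * ln (1 / (1 - r\<^sup>2))) (at_left 1)"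
      using eventually_at_left_1_in_unit r0'
      by eventually_elim (intro C max_modulus_le_exp_powr[OF f], auto)
    hence "eventually (\<lambda>r. log_plus (max_modulus r A) \<le> C + E s0 e * ln (1 / (1 - r))) (at_left 1)"
      by (subst (asm) eventually_at_left_1_power2)
    thus ?thesis unfolding growth_degree_def by (rule Limsup_ratio_le)
  qed
  have "growth_degree A \<le> ereal (real k * (2 + (s0 - 1) * s0 / s0))"
    using upper by (intro tendsto_lowerbound[OF lim eventually_mono[OF ev]]) auto
  moreover have "2 + (s0 - 1) * s0 / s0 = s0 + 1" using s0 by simp
  ultimately show "growth_degree A \<le> ereal (real k * (s0 + 1))" by (simp only:)
  have lower: "lower_growth_degree A \<le> ereal (E l0 e)" if e: "0 < e" "e < 1" for e
  proof -
    obtain C r0 where r0: "r0 < 1" and C: "\<And>r. \<lbrakk>r0 < r; r < 1; max_modulus r f \<le> exp ((1 - r) powr - (l0 + e))\<rbrakk> \<Longrightarrow>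
      log_plus (max_modulus (r\<^sup>2) A) \<le> C + E l0 e * ln (1 / (1 - r\<^sup>2))"
      using key[OF e l0(2,3)] by auto
    have r0': "eventually (\<lambda>r. (0 < r \<and> r < 1) \<and> r0 < r) (at_left 1)"
      using eventually_at_left_1_in_unit
      by (rule eventually_conj) (unfold eventually_at_left_field, use r0 in blast)
    have "lower_growth_order f < ereal (l0 + e)" using l0 e by simp
    hence "frequently (\<lambda>r. log_plus (log_plus (max_modulus r f)) < (l0 + e) * ln (1 / (1 - r))) (at_left 1)"
      unfolding lower_growth_order_def by (rule Liminf_ratio_lessD)
    hence "frequently (\<lambda>r. log_plus (log_plus (max_modulus r f)) < (l0 + e) * ln (1 / (1 - r)) \<and>
        ((0 < r \<and> r < 1) \<and> r0 < r)) (at_left 1)"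
      using r0' by (rule frequently_eventually_frequently)
    hence "frequently (\<lambda>r. log_plus (max_modulus (r\<^sup>2) A) \<le> C + E l0 e * ln (1 / (1 - r\<^sup>2))) (at_left 1)"
      by (rule frequently_elim1) (intro C max_modulus_le_exp_powr[OF f], auto)
    hence "frequently (\<lambda>r. log_plus (max_modulus r A) \<le> C + E l0 e * ln (1 / (1 - r))) (at_left 1)"
      unfolding frequently_def
      using eventually_at_left_1_power2[of "\<lambda>r. \<not> log_plus (max_modulus r A) \<le> C + E l0 e * ln (1 / (1 - r))"] by simp
    thus ?thesis unfolding lower_growth_degree_def by (rule Liminf_ratio_le)
  qed
  show "lower_growth_degree A \<le> ereal (real k * (2 + (s0 - 1) * l0 / s0))"
    using lower by (intro tendsto_lowerbound[OF lim eventually_mono[OF ev]]) auto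
qed

section \<open>Combination of the estimates into the two-sided inequality\<close>

theorem corollary4:
  fixes k :: nat and A f :: "complex \<Rightarrow> complex" and p1 p2 :: real
  assumes "k \<ge> 1"
    and "A analytic_on \<D>"
    and "growth_degree A = ereal p2"
    and "lower_growth_degree A = ereal p1"
    and "2 * real k < real k * (2 + (p2 - 2 * real k) / p2)"
    and "real k * (2 + (p2 - 2 * real k) / p2) < p1"
    and "p1 \<le> p2"
    and "f analytic_on \<D>"
    and "\<And>z. z \<in> \<D> \<Longrightarrow> (deriv ^^ k) f z + A z * f z = 0"
    and "\<exists>z\<in>\<D>. f z \<noteq> 0"
  shows "\<bar>lower_growth_order f - ereal (p1 / real k) + 1\<bar>
           \<le> 1 - lower_growth_order f / growth_order f"
proof -
  have k: "real k \<ge> 1" using assms(1) by simp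
  have A: "A holomorphic_on \<D>" and f: "f holomorphic_on \<D>"
    using assms by (auto intro: analytic_imp_holomorphic)
  have p1: "2 * real k < p1" using assms(5,6) by linarith
  hence p2: "2 * real k < p2" using assms(7) by linarith
  have upper: "growth_order f \<le> ereal (p2 / real k - 1)"
    "lower_growth_order f \<le> ereal ((p2 / real k - 1) * p1 / p2)"
    using growth_orders_upper[OF assms(1) f A assms(9) assms(3) _ assms(4)] p1 p2 k by auto
  note nonneg = growth_orders_nonneg[of f]
  obtain \<sigma> where \<sigma>: "growth_order f = ereal \<sigma>"
    using upper(1) nonneg by (cases "growth_order f") auto
  obtain l where l: "lower_growth_order f = ereal l"
    using upper(2) nonneg by (cases "lower_growth_order f") auto
  have l_nonneg: "0 \<le> l" and l_le: "l \<le> \<sigma>" using nonneg by (auto simp: \<sigma> l)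
  have \<sigma>_le: "\<sigma> \<le> p2 / real k - 1" using upper by (simp add: \<sigma>)
  \<comment> \<open>At this stage it is not known that \<open>\<sigma> > 1\<close>, hence the
    maximum. Since \<open>p2 / k > 2\<close>, the value 1 cannot be the larger one, and the order is
    then determined exactly.\<close>
  have "growth_degree A \<le> ereal (real k * (max \<sigma> 1 + 1))"
    by (rule growth_degrees_upper(1)[OF f A assms(9,10) _ _ l]) (use \<sigma> l_nonneg l_le in auto)
  hence "p2 / real k \<le> max \<sigma> 1 + 1" using k by (simp add: assms(3) pos_divide_le_eq mult.commute)
  moreover have "p2 / real k > 2" using p2 k by (simp add: pos_less_divide_eq)
  ultimately have \<sigma>_eq: "\<sigma> = p2 / real k - 1" and \<sigma>1: "\<sigma> > 1" using \<sigma>_le by (auto simp: max_def split: if_splits)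
  have "lower_growth_degree A \<le> ereal (real k * (2 + (\<sigma> - 1) * l / \<sigma>))"
    by (rule growth_degrees_upper(2)[OF f A assms(9,10) _ _ l]) (use \<sigma> \<sigma>1 l_nonneg l_le in auto)
  hence "p1 / real k \<le> 2 + (\<sigma> - 1) * l / \<sigma>" using k by (simp add: assms(4) pos_divide_le_eq mult.commute)
  hence lower_ineq: "p1 / real k - 2 \<le> l - l / \<sigma>" using \<sigma>1 by (simp add: left_diff_distrib diff_divide_distrib)
  have upper_ineq: "l + l / \<sigma> \<le> p1 / real k"
  proof -
    have "l \<le> \<sigma> * p1 / p2" using upper(2) by (simp add: l \<sigma>_eq)
    \<comment> \<open>The exact value of the order eliminates \<open>p2\<close>: the bound for
      \<open>l\<close> becomes \<open>l * (\<sigma> + 1) \<le> \<sigma> * p1 / k\<close>, and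
      division by \<open>\<sigma>\<close> gives the inequality.\<close>
    moreover have "p2 = real k * (\<sigma> + 1)" using k by (simp add: \<sigma>_eq)
    ultimately have "l * (real k * (\<sigma> + 1)) \<le> \<sigma> * p1"
      using p2 k by (metis less_trans mult_pos_pos pos_le_divide_eq zero_less_numeral zero_less_one less_le_trans)
    hence "l * (\<sigma> + 1) \<le> \<sigma> * (p1 / real k)"
      using k by (simp add: pos_le_divide_eq mult_ac)
    hence "(l * (\<sigma> + 1)) / \<sigma> \<le> p1 / real k" using \<sigma>1 by (simp add: pos_divide_le_eq mult.commute)
    thus ?thesis using \<sigma>1 by (simp add: distrib_left add_divide_distrib)
  qed
  have "\<bar>l - p1 / real k + 1\<bar> \<le> 1 - l / \<sigma>" using lower_ineq upper_ineq by linarith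
  \<comment> \<open>As \<open>\<sigma>\<close> is positive and finite, the quotient of extended
    reals is the real quotient.\<close>
  thus ?thesis using \<sigma>1 by (simp add: \<sigma> l one_ereal_def)
qed

end
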